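(* Let $n\ge 1$, let $b$ be a locally integrable function on $\mathbb{R}^n$ and let $0<\beta<1$. Then the following statements are equivalent: (1) $b\in\dot{\Lambda}_{\beta}(\mathbb{R}^n)$. (2) The maximal commutator $M_b$ is bounded from $L^p(\mathbb{R}^n)$ to $L^q(\mathbb{R}^n)$ for all $p,q$ with $1<p<n/\beta$ and $1/q=1/p-\beta/n$. (3) $M_b$ is bounded from $L^p(\mathbb{R}^n)$ to $L^q(\mathbb{R}^n)$ for some $p,q$ with $1<p<n/\beta$ and $1/q=1/p-\beta/n$. (4) $M_b$ satisfies the weak-type $(1,n/(n-\beta))$ estimate, namely, there exists a positive constant $C$ such that for all $f\in L^1(\mathbb{R}^n)$ and all $\lambda>0$, $$\big|\{x\in\mathbb{R}^n: M_b(f)(x)>\lambda\}\big| \le C\big(\lambda^{-1}\|f\|_{L^1(\mathbb{R}^n)}\big)^{n/(n-\beta)}.$$ (5) $M_b$ is bounded from $L^{n/\beta}(\mathbb{R}^n)$ to $L^{\infty}(\mathbb{R}^n)$.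
   Context: For a locally integrable function $b$ on $\mathbb{R}^n$, the maximal commutator is $$M_b(f)(x)=\sup_{Q\ni x}\frac{1}{|Q|}\int_Q |b(x)-b(y)|\,|f(y)|\,dy,$$ where the supremum is over all cubes $Q\subset\mathbb{R}^n$ containing $x$ (cubes have sides parallel to the coordinate axes) and $|E|$ denotes Lebesgue measure. "Bounded from $X$ to $Y$" means that there is a constant $C$ with $\|M_b(f)\|_Y\le C\|f\|_X$ for all $f\in X$. For $0<\beta<1$, a function $b$ belongs to the Lipschitz space $\dot{\Lambda}_{\beta}(\mathbb{R}^n)$ if there is a constant $C$ such that $|b(x)-b(y)|\le C|x-y|^{\beta}$ for all $x,y\in\mathbb{R}^n$. As usual, functions are identified if they agree almost everywhere, so for a locally integrable $b$, $b\in\dot{\Lambda}_{\beta}(\mathbb{R}^n)$ means that $b$ agrees a.e. with a function satisfying this condition. *)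

theory Defs
  imports "HOL-Analysis.Analysis" "HOL-Probability.Essential_Supremum"
begin

text \<open>
  The domain is \<open>real ^ 'n\<close>, of dimension \<open>CARD('n)\<close>. Functions take values in a type of class
  \<open>{real_normed_field, euclidean_space}\<close>, which covers both real-valued and complex-valued
  functions. Measurability is with respect to the completed Lebesgue measure.
\<close>

definition locally_integrable :: "(real ^ 'n \<Rightarrow> 'a::euclidean_space) \<Rightarrow> bool" where
  "locally_integrable b \<longleftrightarrow> (\<forall>K. compact K \<longrightarrow> b absolutely_integrable_on K)"

definition is_cube :: "(real ^ 'n) set \<Rightarrow> bool" where
  "is_cube Q \<longleftrightarrow> (\<exists>a l. 0 < l \<and> Q = cbox a (a + vec l))"

text \<open>Values in \<open>[0, \<infinity>]\<close>: even for \<open>f\<close> in some \<open>L\<^sup>p\<close>, the averages need not be finite when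
  \<open>b\<close> is merely locally integrable.\<close>

definition maximal_commutator ::
  "(real ^ 'n \<Rightarrow> 'a::{real_normed_field, euclidean_space}) \<Rightarrow> (real ^ 'n \<Rightarrow> 'a) \<Rightarrow> real ^ 'n \<Rightarrow> ennreal"
where
  "maximal_commutator b f x =
     (SUP Q\<in>{Q. is_cube Q \<and> x \<in> Q}.
        (\<integral>\<^sup>+y\<in>Q. ennreal (norm (b x - b y) * norm (f y)) \<partial>lebesgue) / emeasure lebesgue Q)"

text \<open>Powers with exponent \<open>a > 0\<close> on \<open>[0, \<infinity>]\<close>.\<close>

definition ennreal_powr :: "ennreal \<Rightarrow> real \<Rightarrow> ennreal" where
  "ennreal_powr t a = (if t = \<infinity> then \<infinity> else ennreal (enn2real t powr a))"

text \<open>The \<open>L\<^sup>p\<close> norm (\<open>0 < p < \<infinity>\<close>) of a \<open>[0, \<infinity>]\<close>-valued function. As for \<open>esssup\<close>, which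
  serves as the \<open>L\<^sup>\<infinity>\<close> norm, a non-measurable function gets norm \<open>\<infinity>\<close>, so that a finite norm
  includes membership in the space.\<close>

definition ennreal_Lp_norm :: "real \<Rightarrow> (real ^ 'n \<Rightarrow> ennreal) \<Rightarrow> ennreal" where
  "ennreal_Lp_norm p g =
     (if g \<in> borel_measurable lebesgue
      then ennreal_powr (\<integral>\<^sup>+x. ennreal_powr (g x) p \<partial>lebesgue) (1 / p) else \<infinity>)"

definition ennreal_Linf_norm :: "(real ^ 'n \<Rightarrow> ennreal) \<Rightarrow> ennreal" where
  "ennreal_Linf_norm g = esssup lebesgue g"

definition Lp_norm :: "real \<Rightarrow> (real ^ 'n \<Rightarrow> 'a::euclidean_space) \<Rightarrow> ennreal" where
  "Lp_norm p f = ennreal_Lp_norm p (\<lambda>x. ennreal (norm (f x)))"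

definition Lp :: "real \<Rightarrow> (real ^ 'n \<Rightarrow> 'a::euclidean_space) set" where
  "Lp p = {f \<in> borel_measurable lebesgue. Lp_norm p f < \<infinity>}"

text \<open>Boundedness of \<open>T\<close> from \<open>L\<^sup>p\<close> to the space with norm \<open>N\<close>; the constant is finite.\<close>

definition bounded_from_Lp ::
  "((real ^ 'n \<Rightarrow> 'a::euclidean_space) \<Rightarrow> (real ^ 'n \<Rightarrow> ennreal)) \<Rightarrow> real \<Rightarrow>
   ((real ^ 'n \<Rightarrow> ennreal) \<Rightarrow> ennreal) \<Rightarrow> bool"
where
  "bounded_from_Lp T p N \<longleftrightarrow> (\<exists>C::real. \<forall>f\<in>Lp p. N (T f) \<le> ennreal C * Lp_norm p f)"

text \<open>Membership in the homogeneous Lipschitz space, up to equality almost everywhere.\<close>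

definition in_Lipschitz_space :: "real \<Rightarrow> (real ^ 'n \<Rightarrow> 'a::euclidean_space) \<Rightarrow> bool" where
  "in_Lipschitz_space \<beta> b \<longleftrightarrow>
     (\<exists>g. (\<exists>C. \<forall>x y. norm (g x - g y) \<le> C * norm (x - y) powr \<beta>) \<and>
          (AE x in lebesgue. b x = g x))"

end

theory Submission
  imports Defs
begin

text \<open>
  Lipschitz implies bounded: for almost every \<open>x\<close>, \<open>M\<^sub>b f x\<close> is at most a constant times the fractional
  maximal function of order \<open>\<beta>\<close>. By Hedberg's argument the latter is at most
  \<open>\<parallel>f\<parallel>\<^sub>p\<^bsup>s\<^esup> (M f x)\<^bsup>1 - s\<^esup>\<close> with \<open>s = p \<beta> / n\<close>, so that the Hardy--Littlewood theorem gives the strong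
  (\<open>p > 1\<close>) and the weak (\<open>p = 1\<close>) estimate; for \<open>p = n / \<beta>\<close> it is at most a multiple of \<open>\<parallel>f\<parallel>\<^sub>p\<close>.

  Bounded implies Lipschitz: each of the estimates, tested on the indicator function of a cube \<open>Q\<close> of
  side \<open>l\<close>, forbids \<open>M\<^sub>b 1\<^sub>Q > T l\<^bsup>\<beta>\<^esup>\<close> on all of \<open>Q\<close> once \<open>T\<close> is large. Hence some \<open>x \<in> Q\<close> satisfies
  \<open>\<integral>\<^sub>Q |b x - b y| dy \<le> T l\<^bsup>\<beta>\<^esup> |Q|\<close>, and Campanato's characterization applies.
\<close>

subsection \<open>Cubes\<close>

text \<open>The exponents are tuned so that the side l disappears everywhere. In a test on a cube,
  \<open>1 / q = 1 / p - \<beta> / n\<close> makes all powers of l cancel, and only a comparison of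
  \<open>T\<close> with the given constant remains; this is why one large \<open>T\<close> works for
  cubes of all sizes. In Hedberg's splitting, \<open>s = p * \<beta> / n\<close> is the exponent
  that cancels \<open>l powr \<beta>\<close>, and then \<open>(1 - s) * q = p\<close> returns
  exactly the integral that the maximal theorem controls. For p = 1 the weak exponent n / (n -
  \<beta>) is 1 / (1 - s); for p = n / \<beta> one has s = 1 and no maximal function is left.

  Measurability is an obstacle of its own: the supremum runs over uncountably many cubes, and its
  integrand depends on x through a merely measurable b, so semicontinuity does not settle the
  matter. The supremum is therefore rewritten over a countable family of cubes. The pointwise bounds
  hold only almost everywhere because the commutator contains the value \<open>b x\<close> itself,
  while b is Lipschitz only up to a null set.\<close>

lemma mem_cube: "x \<in> cbox a (a + vec l :: real ^ 'n) \<longleftrightarrow> (\<forall>i. a $ i \<le> x $ i \<and> x $ i \<le> a $ i + l)"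
  by (simp add: mem_box_cart)

lemma emeasure_cube:
  assumes "0 \<le> l"
  shows "emeasure lborel (cbox a (a + vec l :: real ^ 'n)) = ennreal (l ^ CARD('n))"
proof -
  have "a \<in> cbox a (a + vec l)" using assms by (simp add: mem_cube)
  then have "measure lborel (cbox a (a + vec l)) = l ^ CARD('n)"
    by (subst content_cbox_cart) auto
  moreover have "emeasure lborel (cbox a (a + vec l)) \<noteq> top"
    using emeasure_lborel_cbox_finite[of a "a + vec l"] by auto
  ultimately show ?thesis
    by (simp add: emeasure_eq_ennreal_measure)
qed

text \<open>Bounding by the sum of the coordinates gives n l instead of the sharp sqrt(n) l; only
  the order in l matters for what follows.\<close>

lemma norm_diff_cube:
  assumes "x \<in> cbox a (a + vec l)" "y \<in> cbox a (a + vec l :: real ^ 'n)"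
  shows "norm (x - y) \<le> real CARD('n) * l"
proof -
  have "norm (x - y) \<le> (\<Sum>i\<in>UNIV. \<bar>(x - y) $ i\<bar>)" by (rule norm_le_l1_cart)
  also have "\<dots> \<le> (\<Sum>i\<in>(UNIV::'n set). l)"
  proof (rule sum_mono)
    fix i show "\<bar>(x - y) $ i\<bar> \<le> l"
      using assms unfolding mem_cube vector_minus_component by (smt (verit))
  qed
  finally show ?thesis by simp
qed

subsection \<open>Powers on the extended half-line\<close>

lemma ennreal_powr_ennreal: "0 \<le> x \<Longrightarrow> ennreal_powr (ennreal x) a = ennreal (x powr a)"
  by (simp add: ennreal_powr_def)

lemma ennreal_powr_top [simp]: "ennreal_powr top a = top"
  by (simp add: ennreal_powr_def)

lemma ennreal_powr_0 [simp]: "ennreal_powr 0 a = 0"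
  by (simp add: ennreal_powr_def)

lemma ennreal_powr_mono: "s \<le> t \<Longrightarrow> 0 \<le> a \<Longrightarrow> ennreal_powr s a \<le> ennreal_powr t a"
  by (cases s; cases t)
     (auto simp: ennreal_powr_ennreal top_unique intro!: ennreal_leI powr_mono2)

lemma ennreal_powr_mult:
  assumes "0 < c"
  shows "ennreal_powr (ennreal c * t) a = ennreal (c powr a) * ennreal_powr t a"
proof (cases t)
  case (real r)
  then show ?thesis using assms
    by (simp add: ennreal_powr_ennreal ennreal_mult[symmetric] powr_mult)
next
  case top
  then show ?thesis using assms by (simp add: ennreal_mult_top)
qed

lemma ennreal_powr_powr: "ennreal_powr (ennreal_powr t a) c = ennreal_powr t (a * c)"
  by (cases t) (auto simp: ennreal_powr_ennreal powr_powr)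

lemma ennreal_powr_less_top_iff [simp]: "ennreal_powr t a < top \<longleftrightarrow> t < top"
  by (cases t) (auto simp: ennreal_powr_ennreal)

lemma measurable_ennreal_powr [measurable]:
  assumes [measurable]: "f \<in> borel_measurable M"
  shows "(\<lambda>x. ennreal_powr (f x) a) \<in> borel_measurable M"
  unfolding ennreal_powr_def by measurable

subsection \<open>The maximal function over cubes\<close>

text \<open>Both maximal operators are instances: with \<open>norm (f y)\<close> as integrand it is
  the Hardy--Littlewood function, and with x frozen in \<open>norm (b x - b y)\<close> it is the
  commutator at x.\<close>

definition cube_maximal :: "(real ^ 'n \<Rightarrow> ennreal) \<Rightarrow> real ^ 'n \<Rightarrow> ennreal" where
  "cube_maximal F x =
     (SUP Q\<in>{Q. is_cube Q \<and> x \<in> Q}. (\<integral>\<^sup>+y\<in>Q. F y \<partial>lebesgue) / emeasure lebesgue Q)"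

lemma maximal_commutator_eq_cube_maximal:
  "maximal_commutator b f x = cube_maximal (\<lambda>y. ennreal (norm (b x - b y) * norm (f y))) x"
  by (simp add: maximal_commutator_def cube_maximal_def)

text \<open>The volume of a cube is positive and finite, so the division can be cleared. Upper
  bounds are proved and exploited in this form.\<close>

lemma cube_maximal_le_iff:
  "cube_maximal F x \<le> z \<longleftrightarrow>
     (\<forall>a l. 0 < l \<longrightarrow> x \<in> cbox a (a + vec l :: real ^ 'n) \<longrightarrow>
        (\<integral>\<^sup>+y\<in>cbox a (a + vec l). F y \<partial>lebesgue) \<le> z * ennreal (l ^ CARD('n)))"
proof -
  have *: "I / ennreal (l ^ CARD('n)) \<le> z \<longleftrightarrow> I \<le> z * ennreal (l ^ CARD('n))" if "0 < l" for I l
  proof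
    assume "I / ennreal (l ^ CARD('n)) \<le> z"
    then have "I / ennreal (l ^ CARD('n)) * ennreal (l ^ CARD('n)) \<le> z * ennreal (l ^ CARD('n))"
      by (rule mult_right_mono) simp
    then show "I \<le> z * ennreal (l ^ CARD('n))"
      using that by (simp add: ennreal_divide_times)
  qed (use that in \<open>auto intro!: divide_le_posI_ennreal simp: mult.commute\<close>)
  have "cube_maximal F x \<le> z \<longleftrightarrow>
     (\<forall>a l. 0 < l \<longrightarrow> x \<in> cbox a (a + vec l) \<longrightarrow>
        (\<integral>\<^sup>+y\<in>cbox a (a + vec l). F y \<partial>lebesgue) / emeasure lebesgue (cbox a (a + vec l)) \<le> z)"
    unfolding cube_maximal_def is_cube_def SUP_le_iff by blast
  also have "\<dots> \<longleftrightarrow> (\<forall>a l. 0 < l \<longrightarrow> x \<in> cbox a (a + vec l :: real ^ 'n) \<longrightarrow>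
        (\<integral>\<^sup>+y\<in>cbox a (a + vec l). F y \<partial>lebesgue) \<le> z * ennreal (l ^ CARD('n)))"
    using * by (simp add: emeasure_cube)
  finally show ?thesis .
qed

lemma nn_integral_cube_le_cube_maximal:
  assumes "0 < l" "x \<in> cbox a (a + vec l :: real ^ 'n)"
  shows "(\<integral>\<^sup>+y\<in>cbox a (a + vec l). F y \<partial>lebesgue) \<le> cube_maximal F x * ennreal (l ^ CARD('n))"
  using cube_maximal_le_iff[of F x "cube_maximal F x"] assms by auto

section \<open>Measurability through countably many cubes\<close>

lemma sigma_finite_lebesgue: "sigma_finite_measure (lebesgue :: 'a::euclidean_space measure)"
proof
  obtain A :: "'a set set" where A: "countable A" "A \<subseteq> sets lborel" "\<Union>A = space lborel"
      "\<forall>a\<in>A. emeasure lborel a \<noteq> \<infinity>"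
    using lborel.sigma_finite_countable by blast
  then show "\<exists>A::'a set set. countable A \<and> A \<subseteq> sets lebesgue \<and> \<Union>A = space lebesgue \<and>
      (\<forall>a\<in>A. emeasure lebesgue a \<noteq> \<infinity>)"
    by (intro exI[of _ A]) (auto simp: subset_iff)
qed

interpretation lebesgue: sigma_finite_measure "lebesgue :: 'a::euclidean_space measure"
  by (rule sigma_finite_lebesgue)

text \<open>Serves Fubini in the layer-cake argument: space carries the completed measure, while the
  height variable lives in \<open>lborel\<close>.\<close>

interpretation lebesgue_lborel: pair_sigma_finite
  "lebesgue :: 'a::euclidean_space measure" "lborel :: 'b::euclidean_space measure"
  by unfold_locales

text \<open>Moving the corner down by less than e/2 in each coordinate costs less than e/2 of side
  length; the other e/2 leaves room for a rational side.\<close>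

lemma cube_subset_dense_cube:
  fixes D :: "(real ^ 'n) set"
  assumes D: "\<And>X. open X \<Longrightarrow> X \<noteq> {} \<Longrightarrow> \<exists>d\<in>D. d \<in> X" and "0 < e"
  obtains d r where "d \<in> D" "r \<in> \<rat>" "r < l + e" "cbox a (a + vec l) \<subseteq> cbox d (d + vec r)"
proof -
  have "box (a - vec (e/2)) a \<noteq> {}"
    using assms(2) by (simp add: interval_ne_empty_cart)
  then obtain d where d: "d \<in> D" "d \<in> box (a - vec (e/2)) a"
    using D[OF open_box] by blast
  obtain r where r: "r \<in> \<rat>" "l + e/2 < r" "r < l + e"
    using Rats_dense_in_real[of "l + e/2" "l + e"] assms(2) by auto
  have "cbox a (a + vec l) \<subseteq> cbox d (d + vec r)"
  proof
    fix x assume x: "x \<in> cbox a (a + vec l)"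
    show "x \<in> cbox d (d + vec r)"
      unfolding mem_cube
    proof
      fix i
      have "a $ i - e/2 < d $ i" "d $ i < a $ i" "a $ i \<le> x $ i" "x $ i \<le> a $ i + l"
        using d x by (auto simp: mem_box_cart)
      then show "d $ i \<le> x $ i \<and> x $ i \<le> d $ i + r" using r by linarith
    qed
  qed
  with that d r show thesis by blast
qed

text \<open>The condition that the cube contains x moves from the index set into an indicator, so
  the index set no longer depends on x and each term is measurable in x. A cube of side l lies in a
  cube of the countable family of side less than l + e, and e tends to 0.\<close>

lemma cube_maximal_eq_countable_SUP:
  fixes D :: "(real ^ 'n) set"
  assumes D: "\<And>X. open X \<Longrightarrow> X \<noteq> {} \<Longrightarrow> \<exists>d\<in>D. d \<in> X"
  shows "cube_maximal F x =
    (SUP (d, r)\<in>D \<times> (\<rat> \<inter> {0<..}).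
       (\<integral>\<^sup>+y\<in>cbox d (d + vec r). F y \<partial>lebesgue) / ennreal (r ^ CARD('n)) * indicator (cbox d (d + vec r)) x)"
    (is "_ = ?S")
proof (rule antisym)
  show "?S \<le> cube_maximal F x"
  proof (rule SUP_least, clarify)
    fix d r assume r: "0 < (r::real)"
    show "(\<integral>\<^sup>+y\<in>cbox d (d + vec r). F y \<partial>lebesgue) / ennreal (r ^ CARD('n)) *
        indicator (cbox d (d + vec r)) x \<le> cube_maximal F x"
    proof (cases "x \<in> cbox d (d + vec r)")
      case True
      then have "(\<integral>\<^sup>+y\<in>cbox d (d + vec r). F y \<partial>lebesgue) / ennreal (r ^ CARD('n)) \<le> cube_maximal F x"
        using r nn_integral_cube_le_cube_maximal[of r x d F]
        by (intro divide_le_posI_ennreal) (auto simp: mult.commute)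
      then show ?thesis using True by simp
    qed simp
  qed
  show "cube_maximal F x \<le> ?S"
    unfolding cube_maximal_le_iff
  proof (intro allI impI)
    fix a :: "real ^ 'n" and l :: real assume l: "0 < l" and x: "x \<in> cbox a (a + vec l)"
    have *: "(\<integral>\<^sup>+y\<in>cbox a (a + vec l). F y \<partial>lebesgue) \<le> ?S * ennreal ((l + e) ^ CARD('n))"
      if "0 < e" for e
    proof -
      obtain d r where dr: "d \<in> D" "r \<in> \<rat>" "r < l + e" "cbox a (a + vec l) \<subseteq> cbox d (d + vec r)"
        using cube_subset_dense_cube[OF D \<open>0 < e\<close>] by metis
      have "0 < r"
      proof -
        have "a \<in> cbox a (a + vec l)" "a + vec l \<in> cbox a (a + vec l)" using l by (auto simp: mem_cube)
        then have "a \<in> cbox d (d + vec r)" "a + vec l \<in> cbox d (d + vec r)" using dr by auto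
        then have "d $ undefined \<le> a $ undefined" "a $ undefined + l \<le> d $ undefined + r"
          by (auto simp: mem_cube)
        then show ?thesis using l by linarith
      qed
      have "(\<integral>\<^sup>+y\<in>cbox a (a + vec l). F y \<partial>lebesgue) \<le> (\<integral>\<^sup>+y\<in>cbox d (d + vec r). F y \<partial>lebesgue)"
        using dr(4) by (intro nn_integral_mono) (auto split: split_indicator)
      also have "\<dots> = (\<integral>\<^sup>+y\<in>cbox d (d + vec r). F y \<partial>lebesgue) / ennreal (r ^ CARD('n)) *
          indicator (cbox d (d + vec r)) x * ennreal (r ^ CARD('n))"
        using \<open>0 < r\<close> x dr(4) by (simp add: ennreal_divide_times subset_iff)
      also have "\<dots> \<le> ?S * ennreal ((l + e) ^ CARD('n))"
        using dr \<open>0 < r\<close>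
        by (intro mult_mono ennreal_leI power_mono SUP_upper2[of "(d, r)"]) auto
      finally show ?thesis .
    qed
    show "(\<integral>\<^sup>+y\<in>cbox a (a + vec l). F y \<partial>lebesgue) \<le> ?S * ennreal (l ^ CARD('n))"
    \<comment> \<open>Multiplication on [0, \<infinity>] passes to the limit when the constant
      factor is finite; the infinite case is trivial because the volume is positive.\<close>
    proof (cases "?S = top")
      case True
      show ?thesis unfolding True using l by (simp add: ennreal_top_mult)
    next
      case False
      have "((\<lambda>e. (l + e) ^ CARD('n)) \<longlongrightarrow> l ^ CARD('n)) (at_right 0)"
        by (auto intro!: tendsto_eq_intros)
      then have "((\<lambda>e. ?S * ennreal ((l + e) ^ CARD('n))) \<longlongrightarrow> ?S * ennreal (l ^ CARD('n))) (at_right 0)"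
        using False l by (intro tendsto_mult_ennreal tendsto_ennrealI tendsto_const) auto
      then show ?thesis
        by (rule tendsto_lowerbound)
           (auto simp: * eventually_at_right_field intro!: exI[of _ 1])
    qed
  qed
qed

text \<open>Letting \<open>G\<close> depend on the evaluation point as well is what covers the
  commutator. Over a fixed cube, the integral is measurable in x by Tonelli.\<close>

lemma measurable_cube_maximal:
  fixes G :: "real ^ 'n \<Rightarrow> real ^ 'n \<Rightarrow> ennreal"
  assumes [measurable]: "case_prod G \<in> borel_measurable (lebesgue \<Otimes>\<^sub>M lebesgue)"
  shows "(\<lambda>x. cube_maximal (G x) x) \<in> borel_measurable lebesgue"
proof -
  obtain D :: "(real ^ 'n) set" where D: "countable D" "\<And>X. open X \<Longrightarrow> X \<noteq> {} \<Longrightarrow> \<exists>d\<in>D. d \<in> X"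
    using countable_dense_exists by blast
  have [measurable]: "cbox d e \<in> sets lebesgue" for d e :: "real ^ 'n" by simp
  have cnt: "countable (D \<times> (\<rat> \<inter> {0<..} :: real set))"
    using D(1) countable_rat by (intro countable_SIGMA) auto
  have meas: "(\<lambda>x. case z of (d, r) \<Rightarrow>
      (\<integral>\<^sup>+y\<in>cbox d (d + vec r). G x y \<partial>lebesgue) / ennreal (r ^ CARD('n)) * indicator (cbox d (d + vec r)) x)
      \<in> borel_measurable lebesgue" for z :: "(real ^ 'n) \<times> real"
    by (cases z) simp
  have "(\<lambda>x. SUP (d, r)\<in>D \<times> (\<rat> \<inter> {0<..}).
      (\<integral>\<^sup>+y\<in>cbox d (d + vec r). G x y \<partial>lebesgue) / ennreal (r ^ CARD('n)) * indicator (cbox d (d + vec r)) x)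
      \<in> borel_measurable lebesgue"
    by (rule borel_measurable_SUP[OF cnt meas])
  then show ?thesis
    by (simp add: cube_maximal_eq_countable_SUP[OF D(2)])
qed

lemma sets_superlevel:
  fixes f :: "'a::euclidean_space \<Rightarrow> ennreal"
  assumes "f \<in> borel_measurable lebesgue"
  shows "{x. c < f x} \<in> sets lebesgue"
proof -
  have "{x \<in> space lebesgue. c < f x} \<in> sets lebesgue"
    using assms by (intro borel_measurable_less) auto
  then show ?thesis by simp
qed

lemma measurable_maximal_commutator:
  assumes [measurable]: "b \<in> borel_measurable lebesgue" "f \<in> borel_measurable lebesgue"
  shows "maximal_commutator b f \<in> borel_measurable lebesgue"
proof -
  have "(\<lambda>x. cube_maximal (\<lambda>y. ennreal (norm (b x - b y) * norm (f y))) x) \<in> borel_measurable lebesgue"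
    by (rule measurable_cube_maximal) measurable
  then show ?thesis
    by (simp add: maximal_commutator_eq_cube_maximal[abs_def])
qed

lemma measurable_cube_maximal_const:
  assumes [measurable]: "F \<in> borel_measurable lebesgue"
  shows "cube_maximal F \<in> borel_measurable lebesgue"
  by (rule measurable_cube_maximal) measurable

subsection \<open>The Hardy--Littlewood maximal theorem\<close>

lemma cball_subset_cube:
  "cball x r \<subseteq> cbox (x - vec r) (x - vec r + vec (2 * r) :: real ^ 'n)"
proof
  fix y assume y: "y \<in> cball x r"
  have "\<bar>(x - y) $ i\<bar> \<le> r" for i
    using component_le_norm_cart[of "x - y" i] y by (simp add: dist_norm)
  then show "y \<in> cbox (x - vec r) (x - vec r + vec (2 * r))"
    unfolding mem_cube vector_minus_component vec_component by (smt (verit))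
qed

text \<open>Sums over the Vitali family are written as integrals against
  \<open>count_space C\<close>, so that sum and integral can be exchanged.\<close>

lemma nn_integral_disjoint_le:
  fixes F :: "'a \<Rightarrow> ennreal"
  assumes "countable C" and [measurable]: "F \<in> borel_measurable M" "\<And>x. x \<in> C \<Longrightarrow> Q x \<in> sets M"
    and disj: "\<And>x y. x \<in> C \<Longrightarrow> y \<in> C \<Longrightarrow> x \<noteq> y \<Longrightarrow> Q x \<inter> Q y = {}"
  shows "(\<integral>\<^sup>+x. (\<integral>\<^sup>+y\<in>Q x. F y \<partial>M) \<partial>count_space C) \<le> (\<integral>\<^sup>+y. F y \<partial>M)"
proof -
  have "(\<integral>\<^sup>+x. (\<integral>\<^sup>+y\<in>Q x. F y \<partial>M) \<partial>count_space C) =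
      (\<integral>\<^sup>+y. (\<integral>\<^sup>+x. F y * indicator (Q x) y \<partial>count_space C) \<partial>M)"
    by (rule nn_integral_count_space_nn_integral[symmetric]) (use assms(1) in measurable)
  also have "\<dots> \<le> (\<integral>\<^sup>+y. F y \<partial>M)"
  proof (rule nn_integral_mono)
    fix y
    show "(\<integral>\<^sup>+x. F y * indicator (Q x) y \<partial>count_space C) \<le> F y"
    proof (cases "\<exists>x\<in>C. y \<in> Q x")
      case True
      then obtain x where x: "x \<in> C" "y \<in> Q x" by blast
      have "(\<integral>\<^sup>+x'. F y * indicator (Q x') y \<partial>count_space C) =
          (\<integral>\<^sup>+x'. F y * indicator {x} x' \<partial>count_space C)"
        using disj x by (intro nn_integral_cong) (auto split: split_indicator)
      also have "\<dots> = F y" using x by (simp add: nn_integral_cmult_indicator)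
      finally show ?thesis by simp
    next
      case False
      then have "(\<integral>\<^sup>+x. F y * indicator (Q x) y \<partial>count_space C) = (\<integral>\<^sup>+x. 0 \<partial>count_space C)"
        by (intro nn_integral_cong) auto
      then show ?thesis by simp
    qed
  qed
  finally show ?thesis .
qed

lemma emeasure_countable_UN_le:
  assumes "countable C" and [measurable]: "\<And>x. x \<in> C \<Longrightarrow> X x \<in> sets M"
  shows "emeasure M (\<Union>x\<in>C. X x) \<le> (\<integral>\<^sup>+x. emeasure M (X x) \<partial>count_space C)"
proof -
  have U: "(\<Union>x\<in>C. X x) \<in> sets M" using assms by (intro sets.countable_UN') auto
  have "emeasure M (\<Union>x\<in>C. X x) = (\<integral>\<^sup>+y. indicator (\<Union>x\<in>C. X x) y \<partial>M)"
    using U by simp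
  also have "\<dots> \<le> (\<integral>\<^sup>+y. (\<integral>\<^sup>+x. indicator (X x) y \<partial>count_space C) \<partial>M)"
  proof (rule nn_integral_mono)
    fix y
    show "indicator (\<Union>x\<in>C. X x) y \<le> (\<integral>\<^sup>+x. indicator (X x) y \<partial>count_space C)"
    proof (cases "\<exists>x\<in>C. y \<in> X x")
      case True
      then obtain x where x: "x \<in> C" "y \<in> X x" by blast
      then have "indicator (\<Union>x\<in>C. X x) y = (indicator (X x) y :: ennreal)"
        by (auto simp: indicator_def)
      then show ?thesis using nn_integral_ge_point[OF x(1), of "\<lambda>x. indicator (X x) y"] by simp
    qed auto
  qed
  also have "\<dots> = (\<integral>\<^sup>+x. emeasure M (X x) \<partial>count_space C)"
    by (subst nn_integral_count_space_nn_integral)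
       (use assms in \<open>auto intro!: nn_integral_cong\<close>)
  finally show ?thesis .
qed

text \<open>A cube of side l lies in a ball of radius n l about any of its points, Vitali enlarges
  the radius by 5, and a cube around that ball has side twice the radius: 10 n l in all.\<close>

definition weak_const :: "'n::finite itself \<Rightarrow> real" where
  "weak_const _ = (10 * real CARD('n)) ^ CARD('n)"

lemma weak_const_pos: "0 < weak_const TYPE('n::finite)"
  by (simp add: weak_const_def)

text \<open>Each point x of the level set has a cube with average above t. Vitali's lemma is applied
  to balls centred at x that contain these cubes: disjoint balls contain disjoint cubes, whose
  integrals add up to at most that of \<open>F\<close>.\<close>

lemma cube_maximal_weak_type:
  fixes F :: "real ^ 'n \<Rightarrow> ennreal"
  assumes [measurable]: "F \<in> borel_measurable lebesgue" and t: "0 < t"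
  shows "emeasure lebesgue {x. ennreal t < cube_maximal F x} \<le>
    ennreal (weak_const TYPE('n) / t) * (\<integral>\<^sup>+y. F y \<partial>lebesgue)"
proof (cases "(\<integral>\<^sup>+y. F y \<partial>lebesgue) = top")
  case True
  then show ?thesis using t weak_const_pos[where 'n='n] by (simp add: ennreal_mult_top)
next
  case False
  define n where "n = CARD('n)"
  have n: "0 < n" by (simp add: n_def)
  define I where "I = enn2real (\<integral>\<^sup>+y. F y \<partial>lebesgue)"
  have I: "(\<integral>\<^sup>+y. F y \<partial>lebesgue) = ennreal I" "0 \<le> I"
    using False by (auto simp: I_def top.not_eq_extremum)
  define E where "E = {x. ennreal t < cube_maximal F x}"
  have "\<exists>a l. 0 < l \<and> x \<in> cbox a (a + vec l) \<and>
      ennreal t * ennreal (l ^ n) < (\<integral>\<^sup>+y\<in>cbox a (a + vec l). F y \<partial>lebesgue)" if "x \<in> E" for x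
    using that cube_maximal_le_iff[of F x "ennreal t"]
    unfolding E_def n_def mem_Collect_eq not_le[symmetric] by blast
  then have "\<forall>x\<in>E. \<exists>z. 0 < snd z \<and> x \<in> cbox (fst z) (fst z + vec (snd z)) \<and>
      ennreal t * ennreal (snd z ^ n) < (\<integral>\<^sup>+y\<in>cbox (fst z) (fst z + vec (snd z)). F y \<partial>lebesgue)"
    by (simp add: split_paired_Ex)
  then obtain z where z: "\<forall>x\<in>E. 0 < snd (z x) \<and> x \<in> cbox (fst (z x)) (fst (z x) + vec (snd (z x))) \<and>
      ennreal t * ennreal (snd (z x) ^ n) <
        (\<integral>\<^sup>+y\<in>cbox (fst (z x)) (fst (z x) + vec (snd (z x))). F y \<partial>lebesgue)"
    unfolding bchoice_iff by (rule exE)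
  define a l where "a x = fst (z x)" and "l x = snd (z x)" for x
  have al: "\<And>x. x \<in> E \<Longrightarrow> 0 < l x" "\<And>x. x \<in> E \<Longrightarrow> x \<in> cbox (a x) (a x + vec (l x))"
      "\<And>x. x \<in> E \<Longrightarrow> ennreal t * ennreal (l x ^ n) < (\<integral>\<^sup>+y\<in>cbox (a x) (a x + vec (l x)). F y \<partial>lebesgue)"
    using z by (simp_all add: a_def l_def)
  have sub: "cbox (a x) (a x + vec (l x)) \<subseteq> cball x (real n * l x)" if "x \<in> E" for x
    using norm_diff_cube[OF al(2)[OF that]] by (auto simp: n_def dist_norm)
  \<comment> \<open>Vitali's lemma requires bounded radii. The average over the cube exceeds t, so t
    l^n is at most the finite total integral, and l is at most l^n once l exceeds 1.\<close>
  have bound: "l x \<le> 1 + I / t" if "x \<in> E" for x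
  proof (cases "l x \<le> 1")
    case False
    have "ennreal t * ennreal (l x ^ n) \<le> (\<integral>\<^sup>+y\<in>cbox (a x) (a x + vec (l x)). F y \<partial>lebesgue)"
      using al(3)[OF that] by simp
    also have "\<dots> \<le> (\<integral>\<^sup>+y. F y \<partial>lebesgue)"
      by (intro nn_integral_mono) (auto split: split_indicator)
    finally have "ennreal (t * l x ^ n) \<le> ennreal I"
      using I t al(1)[OF that] by (simp add: ennreal_mult)
    then have "t * l x ^ n \<le> I" using I by simp
    moreover have "l x \<le> l x ^ n" using False n by (intro self_le_power) auto
    ultimately have "l x \<le> I / t" using t
      by (smt (verit) mult_left_mono pos_le_divide_eq mult.commute)
    then show ?thesis by simp
  qed (use I t in \<open>auto intro: add_increasing2\<close>)
  obtain C where C: "countable C" "C \<subseteq> E"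
      "pairwise (\<lambda>i j. disjnt (cball i (real n * l i)) (cball j (real n * l j))) C"
      "E \<subseteq> (\<Union>i\<in>C. cball i (5 * (real n * l i)))"
  proof (rule Vitali_covering_lemma_cballs[where S = E and K = E and a = "\<lambda>x. x"
        and r = "\<lambda>x. real n * l x" and B = "real n * (1 + I / t)"])
    show "E \<subseteq> (\<Union>i\<in>E. cball i (real n * l i))" using al(1) n by force
    show "0 < real n * l i \<and> real n * l i \<le> real n * (1 + I / t)" if "i \<in> E" for i
      using that al(1) n bound by (auto intro!: mult_left_mono)
  qed blast
  have disj: "cbox (a x) (a x + vec (l x)) \<inter> cbox (a y) (a y + vec (l y)) = {}"
    if "x \<in> C" "y \<in> C" "x \<noteq> y" for x y
  proof -
    have "disjnt (cball x (real n * l x)) (cball y (real n * l y))"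
      using C(3) that by (auto simp: pairwise_def)
    then show ?thesis using sub[of x] sub[of y] that C(2) by (auto simp: disjnt_def)
  qed
  have ball: "emeasure lebesgue (cball x (5 * (real n * l x))) \<le>
      ennreal (weak_const TYPE('n) / t) * (\<integral>\<^sup>+y\<in>cbox (a x) (a x + vec (l x)). F y \<partial>lebesgue)"
    if "x \<in> C" for x
  proof -
    have x: "x \<in> E" using that C by auto
    let ?r = "5 * (real n * l x)"
    have "emeasure lebesgue (cball x ?r) \<le> emeasure lebesgue (cbox (x - vec ?r) (x - vec ?r + vec (2 * ?r)))"
      by (intro emeasure_mono cball_subset_cube) auto
    also have "\<dots> = ennreal ((2 * ?r) ^ n)"
      using al(1)[OF x] by (simp add: emeasure_cube n_def)
    also have "\<dots> = ennreal (weak_const TYPE('n) / t) * (ennreal t * ennreal (l x ^ n))"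
      using t al(1)[OF x]
      by (simp add: ennreal_mult[symmetric] weak_const_def n_def power_mult_distrib field_simps)
    also have "\<dots> \<le> ennreal (weak_const TYPE('n) / t) * (\<integral>\<^sup>+y\<in>cbox (a x) (a x + vec (l x)). F y \<partial>lebesgue)"
      using al(3)[OF x] by (intro mult_left_mono) auto
    finally show ?thesis .
  qed
  have "emeasure lebesgue E \<le> emeasure lebesgue (\<Union>x\<in>C. cball x (5 * (real n * l x)))"
    using C by (intro emeasure_mono sets.countable_UN') auto
  also have "\<dots> \<le> (\<integral>\<^sup>+x. emeasure lebesgue (cball x (5 * (real n * l x))) \<partial>count_space C)"
    using C by (intro emeasure_countable_UN_le) auto
  also have "\<dots> \<le> (\<integral>\<^sup>+x. ennreal (weak_const TYPE('n) / t) *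
      (\<integral>\<^sup>+y\<in>cbox (a x) (a x + vec (l x)). F y \<partial>lebesgue) \<partial>count_space C)"
    using ball by (intro nn_integral_mono) auto
  also have "\<dots> = ennreal (weak_const TYPE('n) / t) *
      (\<integral>\<^sup>+x. (\<integral>\<^sup>+y\<in>cbox (a x) (a x + vec (l x)). F y \<partial>lebesgue) \<partial>count_space C)"
    by (rule nn_integral_cmult) simp
  also have "\<dots> \<le> ennreal (weak_const TYPE('n) / t) * (\<integral>\<^sup>+y. F y \<partial>lebesgue)"
    using C(1) disj by (intro mult_left_mono nn_integral_disjoint_le) auto
  finally show ?thesis unfolding E_def .
qed

text \<open>Only the part of \<open>u\<close> above \<open>t / 2\<close> contributes to the level set at height \<open>t\<close>; this
  truncation is what upgrades the weak estimate to a strong one.\<close>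

lemma cube_maximal_weak_type_truncated:
  fixes u :: "real ^ 'n \<Rightarrow> real"
  assumes [measurable]: "u \<in> borel_measurable lebesgue" and u: "\<And>x. 0 \<le> u x" and t: "0 < t"
  shows "emeasure lebesgue {x. ennreal t < cube_maximal (\<lambda>y. ennreal (u y)) x} \<le>
    ennreal (2 * weak_const TYPE('n) / t) * (\<integral>\<^sup>+y. ennreal (u y) * indicator {y. t < 2 * u y} y \<partial>lebesgue)"
proof -
  let ?v = "\<lambda>y. ennreal (u y) * indicator {y. t < 2 * u y} y"
  have [measurable]: "{y. t < 2 * u y} \<in> sets lebesgue"
    by (rule borel_measurable_less[where M=lebesgue, simplified]) measurable
  have "cube_maximal (\<lambda>y. ennreal (u y)) x \<le> ennreal t" if "\<not> ennreal (t / 2) < cube_maximal ?v x" for x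
    unfolding cube_maximal_le_iff
  proof (intro allI impI)
    fix a :: "real ^ 'n" and l :: real assume l: "0 < l" "x \<in> cbox a (a + vec l)"
    let ?Q = "cbox a (a + vec l)"
    have [measurable]: "?Q \<in> sets lebesgue" by simp
    have "(\<integral>\<^sup>+y\<in>?Q. ennreal (u y) \<partial>lebesgue) \<le> (\<integral>\<^sup>+y. ?v y * indicator ?Q y + ennreal (t/2) * indicator ?Q y \<partial>lebesgue)"
      using t by (intro nn_integral_mono) (auto split: split_indicator intro!: ennreal_leI)
    also have "\<dots> = (\<integral>\<^sup>+y\<in>?Q. ?v y \<partial>lebesgue) + ennreal (t/2) * ennreal (l ^ CARD('n))"
      using l by (subst nn_integral_add) (auto simp: nn_integral_cmult_indicator emeasure_cube)
    also have "\<dots> \<le> ennreal (t/2) * ennreal (l ^ CARD('n)) + ennreal (t/2) * ennreal (l ^ CARD('n))"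
      using that l cube_maximal_le_iff[of ?v x "ennreal (t/2)"]
      by (intro add_right_mono) (auto simp: not_less)
    also have "\<dots> = ennreal t * ennreal (l ^ CARD('n))"
      using l t by (simp add: ennreal_mult[symmetric] ennreal_plus[symmetric] del: ennreal_plus)
    finally show "(\<integral>\<^sup>+y\<in>?Q. ennreal (u y) \<partial>lebesgue) \<le> ennreal t * ennreal (l ^ CARD('n))" .
  qed
  then have sub: "{x. ennreal t < cube_maximal (\<lambda>y. ennreal (u y)) x} \<subseteq> {x. ennreal (t / 2) < cube_maximal ?v x}"
    by (meson Collect_mono not_le)
  have [measurable]: "cube_maximal ?v \<in> borel_measurable lebesgue"
    by (rule measurable_cube_maximal_const) measurable
  have "emeasure lebesgue {x. ennreal t < cube_maximal (\<lambda>y. ennreal (u y)) x} \<le>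
      emeasure lebesgue {x. ennreal (t / 2) < cube_maximal ?v x}"
    by (intro emeasure_mono sub sets_superlevel) measurable
  also have "\<dots> \<le> ennreal (weak_const TYPE('n) / (t / 2)) * (\<integral>\<^sup>+y. ?v y \<partial>lebesgue)"
    using t by (intro cube_maximal_weak_type) auto
  finally show ?thesis by (simp add: mult.commute)
qed

section \<open>Interpolation by the layer-cake formula\<close>

lemma nn_integral_powr:
  assumes "-1 < a" "0 \<le> (c::real)"
  shows "(\<integral>\<^sup>+t. ennreal (t powr a) * indicator {0<..<c} t \<partial>lborel) = ennreal (c powr (a + 1) / (a + 1))"
proof -
  have "((\<lambda>x. x powr a) has_integral (c powr (a+1) / (a+1))) {0<..<c}"
    using has_integral_powr_from_0[OF assms]
    by (simp add: has_integral_Icc_iff_Ioo)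
  then show ?thesis by (intro nn_integral_has_integral_lebesgue') auto
qed

text \<open>The heights below a finite c at most h already contribute c^p. This gives the inequality
  for finite h, and for infinite h it makes the right-hand side exceed every real.\<close>

lemma layer_cake_le:
  assumes "0 < p"
  shows "ennreal_powr h p \<le> (\<integral>\<^sup>+t. ennreal (p * t powr (p - 1)) * indicator {t. 0 < t \<and> ennreal t < h} t \<partial>lborel)"
    (is "_ \<le> ?R")
proof -
  have *: "ennreal (c powr p) \<le> ?R" if "0 \<le> c" "ennreal c \<le> h" for c
  proof -
    have "ennreal (c powr p) = ennreal p * (\<integral>\<^sup>+t. ennreal (t powr (p - 1)) * indicator {0<..<c} t \<partial>lborel)"
      using assms that by (subst nn_integral_powr) (auto simp: ennreal_mult[symmetric])
    also have "\<dots> = (\<integral>\<^sup>+t. ennreal (p * t powr (p - 1)) * indicator {0<..<c} t \<partial>lborel)"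
      using assms by (subst nn_integral_cmult[symmetric]) (auto simp: ennreal_mult mult.assoc)
    also have "\<dots> \<le> ?R"
    proof (intro nn_integral_mono mult_left_mono)
      fix t show "indicator {0<..<c} t \<le> (indicator {t. 0 < t \<and> ennreal t < h} t :: ennreal)"
        using that(2) by (auto split: split_indicator simp: ennreal_lessI intro: less_le_trans[of _ "ennreal c"])
    qed auto
    finally show ?thesis .
  qed
  show ?thesis
  proof (cases h)
    case (real r)
    then show ?thesis using *[of r] by (simp add: ennreal_powr_ennreal)
  next
    case top
    have "?R = top"
    proof (rule ccontr)
      assume "?R \<noteq> top"
      then obtain r where r: "?R = ennreal r" "0 \<le> r" by (cases ?R) auto
      \<comment> \<open>The height is chosen so that its p-th power is r + 1.\<close>
      have "ennreal (((r + 1) powr (1 / p)) powr p) \<le> ennreal r"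
        unfolding r(1)[symmetric] by (rule *) (auto simp: top)
      then show False using r(2) assms by (simp add: powr_powr)
    qed
    then show ?thesis by simp
  qed
qed

lemma cube_maximal_strong_type:
  assumes p: "1 < p"
  shows "\<exists>B>0. \<forall>u\<in>borel_measurable lebesgue. (\<forall>x :: real ^ 'n. 0 \<le> u x) \<longrightarrow>
       (\<integral>\<^sup>+x. ennreal_powr (cube_maximal (\<lambda>y. ennreal (u y)) x) p \<partial>lebesgue) \<le>
       ennreal B * (\<integral>\<^sup>+x. ennreal (u x powr p) \<partial>lebesgue)"
proof (intro exI conjI ballI impI)
  define A where "A = weak_const TYPE('n)"
  have A: "0 < A" by (simp add: A_def weak_const_pos)
  \<comment> \<open>The truncated weak estimate at height t contributes \<open>2 * A / t\<close>,
    which lowers the layer-cake weight to \<open>t powr (p - 2)\<close>. Its integral over 0 < t < 2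
    u x converges at 0 because p > 1, and yields
    \<open>(2 * u x) powr (p - 1) / (p - 1)\<close>.\<close>
  let ?B = "2 * A * p * 2 powr (p - 1) / (p - 1)"
  show "0 < ?B" using A p by simp
  fix u :: "real ^ 'n \<Rightarrow> real"
  assume u[measurable]: "u \<in> borel_measurable lebesgue" and "\<forall>x. 0 \<le> u x"
  then have u0: "\<And>x. 0 \<le> u x" by blast
  let ?h = "cube_maximal (\<lambda>y. ennreal (u y))"
  have [measurable]: "?h \<in> borel_measurable lebesgue"
    by (rule measurable_cube_maximal_const) measurable
  have hset: "{x. ennreal t < ?h x} \<in> sets lebesgue" for t
    by (rule sets_superlevel) measurable
  have "(\<integral>\<^sup>+x. ennreal_powr (?h x) p \<partial>lebesgue) \<le>
      (\<integral>\<^sup>+x. (\<integral>\<^sup>+t. ennreal (p * t powr (p - 1)) * indicator {t. 0 < t \<and> ennreal t < ?h x} t \<partial>lborel) \<partial>lebesgue)"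
    using p by (intro nn_integral_mono layer_cake_le) auto
  \<comment> \<open>The set under the indicator varies with x; as a conditional, the integrand is
    visibly measurable in both variables, as Fubini demands.\<close>
  also have "\<dots> = (\<integral>\<^sup>+x. (\<integral>\<^sup>+t. (if 0 < t \<and> ennreal t < ?h x then ennreal (p * t powr (p - 1)) else 0) \<partial>lborel) \<partial>lebesgue)"
    by (intro nn_integral_cong) (auto split: split_indicator)
  also have "\<dots> = (\<integral>\<^sup>+t. (\<integral>\<^sup>+x. (if 0 < t \<and> ennreal t < ?h x then ennreal (p * t powr (p - 1)) else 0) \<partial>lebesgue) \<partial>lborel)"
    by (rule lebesgue_lborel.Fubini'[symmetric]) measurable
  also have "\<dots> \<le> (\<integral>\<^sup>+t. (\<integral>\<^sup>+x. (if 0 < t \<and> t < 2 * u x then ennreal (2 * A * p * t powr (p - 2) * u x) else 0) \<partial>lebesgue) \<partial>lborel)"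
  proof (rule nn_integral_mono)
    fix t :: real
    show "(\<integral>\<^sup>+x. (if 0 < t \<and> ennreal t < ?h x then ennreal (p * t powr (p - 1)) else 0) \<partial>lebesgue) \<le>
      (\<integral>\<^sup>+x. (if 0 < t \<and> t < 2 * u x then ennreal (2 * A * p * t powr (p - 2) * u x) else 0) \<partial>lebesgue)"
    proof (cases "0 < t")
      case True
      have [measurable]: "{y. t < 2 * u y} \<in> sets lebesgue"
        by (rule borel_measurable_less[where M=lebesgue, simplified]) measurable
      have "(\<integral>\<^sup>+x. (if 0 < t \<and> ennreal t < ?h x then ennreal (p * t powr (p - 1)) else 0) \<partial>lebesgue) =
          (\<integral>\<^sup>+x. ennreal (p * t powr (p - 1)) * indicator {x. ennreal t < ?h x} x \<partial>lebesgue)"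
        using True by (intro nn_integral_cong) (auto split: split_indicator)
      also have "\<dots> = ennreal (p * t powr (p - 1)) * emeasure lebesgue {x. ennreal t < ?h x}"
        by (rule nn_integral_cmult_indicator) (rule hset)
      also have "\<dots> \<le> ennreal (p * t powr (p - 1)) * (ennreal (2 * A / t) *
          (\<integral>\<^sup>+y. ennreal (u y) * indicator {y. t < 2 * u y} y \<partial>lebesgue))"
        unfolding A_def using True u0 by (intro mult_left_mono cube_maximal_weak_type_truncated) auto
      also have "\<dots> = ennreal (2 * A * p * t powr (p - 2)) *
          (\<integral>\<^sup>+y. ennreal (u y) * indicator {y. t < 2 * u y} y \<partial>lebesgue)"
      proof -
        have "t powr (p - 1) = t powr (p - 2) * t"
          using True powr_add[of t "p - 2" 1] by simp
        then have "p * t powr (p - 1) * (2 * A / t) = 2 * A * p * t powr (p - 2)"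
          using True by simp
        then show ?thesis
          using True A p by (simp add: mult.assoc[symmetric] ennreal_mult[symmetric])
      qed
      also have "\<dots> = (\<integral>\<^sup>+y. ennreal (2 * A * p * t powr (p - 2)) * (ennreal (u y) * indicator {y. t < 2 * u y} y) \<partial>lebesgue)"
        by (rule nn_integral_cmult[symmetric]) measurable
      also have "\<dots> = (\<integral>\<^sup>+x. (if 0 < t \<and> t < 2 * u x then ennreal (2 * A * p * t powr (p - 2) * u x) else 0) \<partial>lebesgue)"
        using True A p u0 by (intro nn_integral_cong) (auto split: split_indicator simp: ennreal_mult)
      finally show ?thesis .
    qed auto
  qed
  also have "\<dots> = (\<integral>\<^sup>+x. (\<integral>\<^sup>+t. (if 0 < t \<and> t < 2 * u x then ennreal (2 * A * p * t powr (p - 2) * u x) else 0) \<partial>lborel) \<partial>lebesgue)"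
    by (rule lebesgue_lborel.Fubini') measurable
  also have "\<dots> = (\<integral>\<^sup>+x. ennreal ?B * ennreal (u x powr p) \<partial>lebesgue)"
  proof (rule nn_integral_cong)
    fix x
    have "(\<integral>\<^sup>+t. (if 0 < t \<and> t < 2 * u x then ennreal (2 * A * p * t powr (p - 2) * u x) else 0) \<partial>lborel) =
        (\<integral>\<^sup>+t. ennreal (2 * A * p * u x) * (ennreal (t powr (p - 2)) * indicator {0<..<2 * u x} t) \<partial>lborel)"
      using A p u0 by (intro nn_integral_cong) (auto split: split_indicator simp: ennreal_mult[symmetric] mult_ac)
    also have "\<dots> = ennreal (2 * A * p * u x) * ennreal ((2 * u x) powr (p - 1) / (p - 1))"
      using p u0 by (subst nn_integral_cmult) (auto simp: nn_integral_powr)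
    also have "\<dots> = ennreal ?B * ennreal (u x powr p)"
    proof -
      have "u x * u x powr (p - 1) = u x powr p"
        using u0[of x] powr_add[of "u x" 1 "p - 1"] by (cases "u x = 0") auto
      then have "2 * A * p * u x * ((2 * u x) powr (p - 1) / (p - 1)) = ?B * u x powr p"
        using u0[of x] by (simp add: powr_mult)
      then show ?thesis
        using A p u0[of x] by (simp add: ennreal_mult[symmetric])
    qed
    finally show "(\<integral>\<^sup>+t. (if 0 < t \<and> t < 2 * u x then ennreal (2 * A * p * t powr (p - 2) * u x) else 0) \<partial>lborel) =
      ennreal ?B * ennreal (u x powr p)" .
  qed
  also have "\<dots> = ennreal ?B * (\<integral>\<^sup>+x. ennreal (u x powr p) \<partial>lebesgue)"
    by (rule nn_integral_cmult) measurable
  finally show "(\<integral>\<^sup>+x. ennreal_powr (?h x) p \<partial>lebesgue) \<le> ennreal ?B * (\<integral>\<^sup>+x. ennreal (u x powr p) \<partial>lebesgue)" .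
qed

subsection \<open>Oscillation over cubes and the Lipschitz condition\<close>

lemma nn_integral_subset_mono:
  assumes "Q \<subseteq> R"
  shows "(\<integral>\<^sup>+y\<in>Q. F y \<partial>M) \<le> (\<integral>\<^sup>+y\<in>R. F y \<partial>M)"
  using assms by (intro nn_integral_mono) (auto split: split_indicator)

text \<open>The distance of u and v is averaged over the smaller cube, where b serves as
  intermediate point. Both hypotheses are measured against the volume of that cube, so the ratio of
  the volumes enters through \<open>L\<close>.\<close>

lemma cube_constants_close:
  fixes b :: "real ^ 'n \<Rightarrow> 'a::euclidean_space"
  assumes [measurable]: "b \<in> borel_measurable lebesgue" and r: "0 < r" "0 \<le> K" "0 \<le> L"
    and sub: "cbox a (a + vec r) \<subseteq> cbox d (d + vec s)"
    and 1: "(\<integral>\<^sup>+y\<in>cbox a (a + vec r). ennreal (norm (b y - u)) \<partial>lebesgue) \<le> ennreal (K * r ^ CARD('n))"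
    and 2: "(\<integral>\<^sup>+y\<in>cbox d (d + vec s). ennreal (norm (b y - v)) \<partial>lebesgue) \<le> ennreal (L * r ^ CARD('n))"
  shows "norm (u - v) \<le> K + L"
proof -
  let ?Q = "cbox a (a + vec r)"
  have [measurable]: "?Q \<in> sets lebesgue" by simp
  have "ennreal (norm (u - v) * r ^ CARD('n)) = (\<integral>\<^sup>+y\<in>?Q. ennreal (norm (u - v)) \<partial>lebesgue)"
    using r by (simp add: nn_integral_cmult_indicator emeasure_cube ennreal_mult)
  also have "\<dots> \<le> (\<integral>\<^sup>+y. ennreal (norm (b y - u)) * indicator ?Q y + ennreal (norm (b y - v)) * indicator ?Q y \<partial>lebesgue)"
  proof (rule nn_integral_mono)
    fix y
    have "norm (u - v) \<le> norm (b y - u) + norm (b y - v)"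
      using norm_triangle_ineq4[of "b y - v" "b y - u"] by (simp add: algebra_simps)
    then show "ennreal (norm (u - v)) * indicator ?Q y \<le>
        ennreal (norm (b y - u)) * indicator ?Q y + ennreal (norm (b y - v)) * indicator ?Q y"
      by (auto split: split_indicator simp: ennreal_plus[symmetric] simp del: ennreal_plus intro!: ennreal_leI)
  qed
  also have "\<dots> = (\<integral>\<^sup>+y\<in>?Q. ennreal (norm (b y - u)) \<partial>lebesgue) + (\<integral>\<^sup>+y\<in>?Q. ennreal (norm (b y - v)) \<partial>lebesgue)"
    by (rule nn_integral_add) measurable
  also have "\<dots> \<le> ennreal (K * r ^ CARD('n)) + ennreal (L * r ^ CARD('n))"
    using order_trans[OF nn_integral_subset_mono[OF sub] 2] by (intro add_mono 1)
  also have "\<dots> = ennreal ((K + L) * r ^ CARD('n))"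
    using r by (simp add: ennreal_plus[symmetric] distrib_right del: ennreal_plus)
  finally show ?thesis
    using r by (subst (asm) ennreal_le_iff) auto
qed

text \<open>A unit cube is covered by about N^n cubes of side 1/N, whose integrals sum to at most a
  constant times N^(-\<beta>). Overlaps do no harm because \<open>h\<close> is nonnegative.\<close>

lemma AE_zero_of_small_cube_integrals:
  fixes h :: "real ^ 'n \<Rightarrow> ennreal"
  assumes [measurable]: "h \<in> borel_measurable lebesgue" and "0 < \<beta>" "0 \<le> K"
    and small: "\<And>a l. 0 < l \<Longrightarrow>
      (\<integral>\<^sup>+y\<in>cbox a (a + vec l). h y \<partial>lebesgue) \<le> ennreal (K * l powr \<beta> * l ^ CARD('n))"
  shows "AE x in lebesgue. h x = 0"
proof -
  have zero: "(\<integral>\<^sup>+y\<in>cbox a (a + vec 1). h y \<partial>lebesgue) = 0" for a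
  proof -
    have *: "(\<integral>\<^sup>+y\<in>cbox a (a + vec 1). h y \<partial>lebesgue) \<le> ennreal (2 ^ CARD('n) * K * (1 / Suc m) powr \<beta>)" for m
    proof -
      define N where "N = Suc m"
      have N: "0 < N" by (simp add: N_def)
      define c :: "('n \<Rightarrow> nat) \<Rightarrow> real ^ 'n" where "c z = a + (\<chi> i. real (z i) / N)" for z
      \<comment> \<open>The index N is included because the floor reaches N on the upper faces. The
        resulting count (N + 1)^n costs the factor 2^n below.\<close>
      define Z where "Z = PiE (UNIV :: 'n set) (\<lambda>_. {..N})"
      have Z: "finite Z" "card Z = (N + 1) ^ CARD('n)"
        by (auto simp: Z_def card_PiE intro!: finite_PiE)
      have cover: "cbox a (a + vec 1) \<subseteq> (\<Union>z\<in>Z. cbox (c z) (c z + vec (1 / N)))"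
      proof
        fix y assume y: "y \<in> cbox a (a + vec 1)"
        define z where "z i = nat \<lfloor>N * (y $ i - a $ i)\<rfloor>" for i
        have yi: "0 \<le> y $ i - a $ i" "y $ i - a $ i \<le> 1" for i
          using y unfolding mem_cube by (auto simp: algebra_simps)
        have rz: "real (z i) = of_int \<lfloor>N * (y $ i - a $ i)\<rfloor>" for i
          using yi[of i] by (simp add: z_def)
        have "z i \<le> N" for i
        proof -
          have "real (z i) \<le> N * (y $ i - a $ i)" unfolding rz by (rule of_int_floor_le)
          also have "\<dots> \<le> real N * 1" using yi[of i] by (intro mult_left_mono) auto
          finally show ?thesis by simp
        qed
        then have "z \<in> Z" by (auto simp: Z_def)
        moreover have "y \<in> cbox (c z) (c z + vec (1 / N))"
          unfolding mem_cube
        proof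
          fix i
          have "real (z i) \<le> N * (y $ i - a $ i)" "N * (y $ i - a $ i) \<le> real (z i) + 1"
            unfolding rz by linarith+
          then show "c z $ i \<le> y $ i \<and> y $ i \<le> c z $ i + 1 / N"
            using N by (simp add: c_def field_simps)
        qed
        ultimately show "y \<in> (\<Union>z\<in>Z. cbox (c z) (c z + vec (1 / N)))" by blast
      qed
      have "(\<integral>\<^sup>+y\<in>cbox a (a + vec 1). h y \<partial>lebesgue) \<le>
          (\<integral>\<^sup>+y. (\<Sum>z\<in>Z. h y * indicator (cbox (c z) (c z + vec (1 / N))) y) \<partial>lebesgue)"
      proof (rule nn_integral_mono)
        fix y
        show "h y * indicator (cbox a (a + vec 1)) y \<le>
            (\<Sum>z\<in>Z. h y * indicator (cbox (c z) (c z + vec (1 / N))) y)"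
        proof (cases "y \<in> cbox a (a + vec 1)")
          case True
          then obtain z where z: "z \<in> Z" "y \<in> cbox (c z) (c z + vec (1 / N))" using cover by blast
          have "h y * indicator (cbox (c z) (c z + vec (1 / N))) y \<le>
              (\<Sum>z\<in>Z. h y * indicator (cbox (c z) (c z + vec (1 / N))) y)"
            using Z(1) z(1) by (intro member_le_sum) auto
          then show ?thesis using True z(2) by simp
        qed simp
      qed
      also have "\<dots> = (\<Sum>z\<in>Z. (\<integral>\<^sup>+y\<in>cbox (c z) (c z + vec (1 / N)). h y \<partial>lebesgue))"
        by (rule nn_integral_sum) (auto intro!: borel_measurable_times_ennreal borel_measurable_indicator)
      also have "\<dots> \<le> (\<Sum>z\<in>Z. ennreal (K * (1 / N) powr \<beta> * (1 / N) ^ CARD('n)))"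
        using N by (intro sum_mono small) auto
      also have "\<dots> = ennreal (((N + 1) ^ CARD('n)) * (K * (1 / N) powr \<beta> * (1 / N) ^ CARD('n)))"
        using assms(3) by (simp add: Z(2) ennreal_mult ennreal_of_nat_eq_real_of_nat)
      also have "\<dots> \<le> ennreal (2 ^ CARD('n) * K * (1 / N) powr \<beta>)"
      proof (rule ennreal_leI)
        have "((real N + 1) * (1 / N)) ^ CARD('n) \<le> 2 ^ CARD('n)"
          using N by (intro power_mono) (auto simp: field_simps)
        then have "((real N + 1) * (1 / N)) ^ CARD('n) * (K * (1 / N) powr \<beta>) \<le> 2 ^ CARD('n) * (K * (1 / N) powr \<beta>)"
          using assms(3) by (intro mult_right_mono) auto
        then show "real ((N + 1) ^ CARD('n)) * (K * (1 / N) powr \<beta> * (1 / N) ^ CARD('n)) \<le> 2 ^ CARD('n) * K * (1 / N) powr \<beta>"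
          by (simp only: power_mult_distrib of_nat_power of_nat_add of_nat_1 mult_ac)
      qed
      finally show ?thesis by (simp add: N_def)
    qed
    have "(\<lambda>m. 2 ^ CARD('n) * K * (1 / real (Suc m)) powr \<beta>) \<longlonglongrightarrow> 2 ^ CARD('n) * K * 0"
    proof (intro tendsto_mult tendsto_const)
      have "((\<lambda>m. 1 / real (Suc m)) \<longlongrightarrow> 0) sequentially"
        using LIMSEQ_inverse_real_of_nat by (simp add: inverse_eq_divide)
      then show "(\<lambda>m. (1 / real (Suc m)) powr \<beta>) \<longlonglongrightarrow> 0"
        using tendsto_powr2[of "\<lambda>m. 1 / real (Suc m)" 0 sequentially "\<lambda>_. \<beta>" \<beta>] \<open>0 < \<beta>\<close> by auto
    qed
    then have "(\<lambda>m. ennreal (2 ^ CARD('n) * K * (1 / real (Suc m)) powr \<beta>)) \<longlonglongrightarrow> ennreal 0"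
      by (intro tendsto_ennrealI) simp
    then have "(\<integral>\<^sup>+y\<in>cbox a (a + vec 1). h y \<partial>lebesgue) \<le> ennreal 0"
      by (rule LIMSEQ_le_const) (use * in auto)
    then show ?thesis by simp
  qed
  \<comment> \<open>Unit cubes with corners in a countable dense set cover the space, so only
    countably many null sets are united.\<close>
  obtain D :: "(real ^ 'n) set" where D: "countable D" "\<And>X. open X \<Longrightarrow> X \<noteq> {} \<Longrightarrow> \<exists>d\<in>D. d \<in> X"
    using countable_dense_exists by blast
  have "AE x in lebesgue. \<forall>a\<in>D. h x * indicator (cbox a (a + vec 1)) x = 0"
    using D(1)
  proof (rule AE_ball_countable[THEN iffD2, rule_format])
    fix a :: "real ^ 'n"
    have [measurable]: "cbox a (a + vec 1) \<in> sets lebesgue" by simp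
    show "AE x in lebesgue. h x * indicator (cbox a (a + vec 1)) x = 0"
      using zero[of a] by (subst (asm) nn_integral_0_iff_AE)
        (auto intro!: borel_measurable_times_ennreal borel_measurable_indicator)
  qed
  moreover have "\<exists>a\<in>D. x \<in> cbox a (a + vec 1)" for x
  proof -
    have "box (x - vec 1) x \<noteq> {}" by (simp add: interval_ne_empty_cart)
    then obtain a where a: "a \<in> D" "a \<in> box (x - vec 1) x" using D(2)[OF open_box] by blast
    then have "x \<in> cbox a (a + vec 1)"
      unfolding mem_cube by (auto simp: mem_box_cart less_imp_le) (smt (verit))
    then show ?thesis using a by blast
  qed
  ultimately show ?thesis
    by (elim AE_mp[OF _ AE_I2]) (metis indicator_simps(1) mult.right_neutral)
qed

lemma centered_cube:
  "cbox (x - vec r) (x - vec r + vec (2 * r) :: real ^ 'n) = {y. \<forall>i. \<bar>y $ i - x $ i\<bar> \<le> r}"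
proof -
  have "(x $ i - r \<le> y $ i \<and> y $ i \<le> x $ i - r + 2 * r) \<longleftrightarrow> \<bar>y $ i - x $ i\<bar> \<le> r" for y :: "real ^ 'n" and i
    by linarith
  then show ?thesis by (auto simp: mem_cube)
qed

text \<open>Campanato's characterization of the Lipschitz condition. The representative of \<open>b\<close> is the limit
  of the constants \<open>c x r\<close> as \<open>r\<close> tends to \<open>0\<close>; no differentiation theorem is needed, because the
  oscillation bound transfers to \<open>b - g\<close>, whose integral then vanishes by subdividing cubes.\<close>

lemma in_Lipschitz_space_if_oscillation:
  fixes b :: "real ^ 'n \<Rightarrow> 'a::euclidean_space"
  assumes [measurable]: "b \<in> borel_measurable lebesgue" and \<beta>: "0 < \<beta>" and T: "0 \<le> T"
    and osc: "\<And>a l. 0 < l \<Longrightarrow> \<exists>c.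
      (\<integral>\<^sup>+y\<in>cbox a (a + vec l). ennreal (norm (b y - c)) \<partial>lebesgue) \<le> ennreal (T * l powr \<beta> * l ^ CARD('n))"
  shows "in_Lipschitz_space \<beta> b"
proof -
  define n where "n = CARD('n)"
  \<comment> \<open>Centred cubes are nested as r shrinks, so the constants at one point can be
    compared across scales.\<close>
  define Q where "Q x r = cbox (x - vec r) (x - vec r + vec (2 * r))" for x :: "real ^ 'n" and r :: real
  have "\<forall>x r. \<exists>c. 0 < r \<longrightarrow> (\<integral>\<^sup>+y\<in>Q x r. ennreal (norm (b y - c)) \<partial>lebesgue) \<le> ennreal (T * (2 * r) powr \<beta> * (2 * r) ^ n)"
    using osc unfolding Q_def n_def by (meson mult_pos_pos zero_less_numeral)
  then obtain c where "\<forall>x r. 0 < r \<longrightarrow>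
      (\<integral>\<^sup>+y\<in>Q x r. ennreal (norm (b y - c x r)) \<partial>lebesgue) \<le> ennreal (T * (2 * r) powr \<beta> * (2 * r) ^ n)"
    unfolding choice_iff by (rule exE)
  then have c: "\<And>x r. 0 < r \<Longrightarrow>
      (\<integral>\<^sup>+y\<in>Q x r. ennreal (norm (b y - c x r)) \<partial>lebesgue) \<le> ennreal (T * (2 * r) powr \<beta> * (2 * r) ^ n)"
    by blast
  \<comment> \<open>The factor \<open>4 ^ n\<close> bounds the volume ratio for s at most 4 r, and
    \<open>2 powr \<beta>\<close> comes from the side 2 s. Below, the ratio s / r never exceeds
    2.\<close>
  define K where "K = T * 2 powr \<beta> * (1 + 4 ^ n)"
  have K: "0 \<le> K" using T by (simp add: K_def)
  have step: "norm (c x r - c y s) \<le> K * s powr \<beta>"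
    if "0 < r" "r \<le> s" "s \<le> 4 * r" and sub: "Q x r \<subseteq> Q y s" for x y r s
  proof -
    have s: "0 < s" using that by simp
    have "norm (c x r - c y s) \<le> T * (2 * r) powr \<beta> + T * (2 * s) powr \<beta> * 4 ^ n"
    proof (rule cube_constants_close[OF assms(1) _ _ _ sub[unfolded Q_def]])
      show "(\<integral>\<^sup>+y\<in>cbox (x - vec r) (x - vec r + vec (2 * r)). ennreal (norm (b y - c x r)) \<partial>lebesgue)
          \<le> ennreal (T * (2 * r) powr \<beta> * (2 * r) ^ CARD('n))"
        using c[OF that(1)] by (simp add: Q_def n_def)
      have "(2 * s) ^ n \<le> (4 * (2 * r)) ^ n" using that by (intro power_mono) auto
      also have "\<dots> = 4 ^ n * (2 * r) ^ n" by (rule power_mult_distrib)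
      finally have "T * (2 * s) powr \<beta> * (2 * s) ^ n \<le> T * (2 * s) powr \<beta> * (4 ^ n * (2 * r) ^ n)"
        by (rule mult_left_mono) (use T in auto)
      then show "(\<integral>\<^sup>+z\<in>cbox (y - vec s) (y - vec s + vec (2 * s)). ennreal (norm (b z - c y s)) \<partial>lebesgue)
          \<le> ennreal (T * (2 * s) powr \<beta> * 4 ^ n * (2 * r) ^ CARD('n))"
        using order_trans[OF c[OF s] ennreal_leI] by (simp add: Q_def n_def mult.assoc)
    qed (use that T in auto)
    also have "\<dots> \<le> T * (2 * s) powr \<beta> + T * (2 * s) powr \<beta> * 4 ^ n"
      using that T \<beta> by (intro add_right_mono mult_left_mono powr_mono2) auto
    also have "\<dots> = K * s powr \<beta>"
      using s by (simp add: K_def powr_mult algebra_simps)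
    finally show ?thesis .
  qed
  have Q_mono: "Q x r \<subseteq> Q x s" if "r \<le> s" for x r s
    using that unfolding Q_def centered_cube by (auto intro: order_trans)
  define \<theta> where "\<theta> = (1 / 2) powr \<beta>"
  have \<theta>: "0 < \<theta>" "\<theta> < 1"
    using \<beta> powr_less_mono2[of \<beta> "1/2" 1] by (auto simp: \<theta>_def)
  \<comment> \<open>The sum of the geometric series of dyadic errors. As the fixed point of
    \<open>L * \<theta> + K = L\<close>, it survives each halving of the radius in the induction
    below, so the bound does not depend on the number k of halvings.\<close>
  define L where "L = K / (1 - \<theta>)"
  have L: "0 \<le> L" "L * \<theta> + K = L" using K \<theta> by (auto simp: L_def field_simps)
  have "norm (c x r - c x s) \<le> L * s powr \<beta>" if "0 < r" "r \<le> s" "s \<le> 2 ^ k * r" for x r s k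
    using that
  proof (induction k arbitrary: s)
    case 0
    then show ?case using L by simp
  next
    case (Suc k)
    show ?case
    proof (cases "r \<le> s / 2")
      case True
      have "norm (c x r - c x (s/2)) \<le> L * (s/2) powr \<beta>"
        using Suc.prems True by (intro Suc.IH) auto
      moreover have "norm (c x (s/2) - c x s) \<le> K * s powr \<beta>"
        using Suc.prems by (intro step Q_mono) auto
      ultimately have "norm (c x r - c x s) \<le> L * (s/2) powr \<beta> + K * s powr \<beta>"
        using norm_triangle_ineq[of "c x r - c x (s/2)" "c x (s/2) - c x s"] by simp
      also have "\<dots> = (L * \<theta> + K) * s powr \<beta>"
        using Suc.prems powr_mult[of s "1/2" \<beta>] by (simp add: \<theta>_def algebra_simps)
      finally show ?thesis by (simp add: L)
    next
      case False
      have "K \<le> L" using L \<theta> by (smt (verit) mult_nonneg_nonneg)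
      have "norm (c x r - c x s) \<le> K * s powr \<beta>"
        using Suc.prems False by (intro step Q_mono) auto
      also have "\<dots> \<le> L * s powr \<beta>" using \<open>K \<le> L\<close> by (intro mult_right_mono) auto
      finally show ?thesis .
    qed
  qed
  then have scale: "norm (c x r - c x s) \<le> L * s powr \<beta>" if "0 < r" "r \<le> s" for x r s
    using that real_arch_pow[of 2 "s / r"] by (metis less_imp_le one_less_numeral_iff pos_divide_less_eq semiring_norm(76))
  define \<rho> :: "nat \<Rightarrow> real" where "\<rho> k = 1 / Suc k" for k
  have \<rho>: "0 < \<rho> k" for k by (simp add: \<rho>_def)
  have \<rho>0: "\<rho> \<longlonglongrightarrow> 0"
    using LIMSEQ_inverse_real_of_nat by (simp add: \<rho>_def[abs_def] inverse_eq_divide)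
  have \<rho>mono: "\<rho> m \<le> \<rho> k" if "k \<le> m" for k m
    using that by (simp add: \<rho>_def frac_le)
  have \<rho>pow: "(\<lambda>k. L * \<rho> k powr \<beta>) \<longlonglongrightarrow> 0"
    using tendsto_mult[OF tendsto_const[of L] tendsto_powr2[OF \<rho>0 tendsto_const[of \<beta>]]] \<beta> \<rho> 
    by (simp add: less_imp_le)
  have cauchy: "Cauchy (\<lambda>k. c x (\<rho> k))" for x
  proof (rule metric_CauchyI)
    fix e :: real assume "0 < e"
    then obtain M where M: "L * \<rho> M powr \<beta> < e / 2"
      using LIMSEQ_D[OF \<rho>pow, of "e/2"] L by force
    have "dist (c x (\<rho> j)) (c x (\<rho> k)) < e" if "M \<le> j" "M \<le> k" for j k
    proof -
      have "norm (c x (\<rho> j) - c x (\<rho> M)) < e / 2" "norm (c x (\<rho> k) - c x (\<rho> M)) < e / 2"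
        using scale[OF \<rho> \<rho>mono, of M j x] scale[OF \<rho> \<rho>mono, of M k x] M that by auto
      then show ?thesis
        by (metis dist_norm dist_triangle_half_l)
    qed
    then show "\<exists>M. \<forall>j\<ge>M. \<forall>k\<ge>M. dist (c x (\<rho> j)) (c x (\<rho> k)) < e" by blast
  qed
  define g where "g x = lim (\<lambda>k. c x (\<rho> k))" for x
  have g: "(\<lambda>k. c x (\<rho> k)) \<longlonglongrightarrow> g x" for x
    unfolding g_def using cauchy[of x] by (simp add: Cauchy_convergent_iff convergent_LIMSEQ_iff)
  have g_c: "norm (g x - c x s) \<le> L * s powr \<beta>" if "0 < s" for x s
  proof (rule tendsto_upperbound)
    show "(\<lambda>k. norm (c x (\<rho> k) - c x s)) \<longlonglongrightarrow> norm (g x - c x s)"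
      by (intro tendsto_intros g)
    have "\<forall>\<^sub>F k in sequentially. \<rho> k < s" using \<rho>0 that by (rule order_tendstoD(2))
    then show "\<forall>\<^sub>F k in sequentially. norm (c x (\<rho> k) - c x s) \<le> L * s powr \<beta>"
      by (rule eventually_mono) (use scale[OF \<rho>] in auto)
  qed auto
  \<comment> \<open>The path runs from \<open>g x\<close> to \<open>c x d\<close>, then to
    \<open>c y (2 * d)\<close> and to \<open>g y\<close>, with d the distance of x and y. The
    doubled radius is what makes the cube about y contain the cube about x.\<close>
  define P where "P = L + (K + L) * 2 powr \<beta>"
  have P: "0 \<le> P" using L K by (simp add: P_def)
  have lip: "norm (g x - g y) \<le> P * norm (x - y) powr \<beta>" for x y
  proof (cases "x = y")
    case False
    define d where "d = norm (x - y)"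
    have d: "0 < d" using False by (simp add: d_def)
    have "Q x d \<subseteq> Q y (2 * d)"
    proof
      fix z assume z: "z \<in> Q x d"
      have "\<bar>z $ i - y $ i\<bar> \<le> 2 * d" for i
      proof -
        have "\<bar>z $ i - x $ i\<bar> \<le> d" using z by (auto simp: Q_def centered_cube)
        moreover have "\<bar>x $ i - y $ i\<bar> \<le> d"
          using component_le_norm_cart[of "x - y" i] by (simp add: d_def)
        ultimately show ?thesis by linarith
      qed
      then show "z \<in> Q y (2 * d)" unfolding Q_def centered_cube by simp
    qed
    then have "norm (c x d - c y (2 * d)) \<le> K * (2 * d) powr \<beta>"
      using d by (intro step) auto
    then have "norm (g x - g y) \<le> L * d powr \<beta> + K * (2 * d) powr \<beta> + L * (2 * d) powr \<beta>"
      using g_c[OF d, of x] g_c[of "2 * d" y] d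
        norm_triangle_ineq[of "g x - c x d" "c x d - c y (2 * d)"]
        norm_triangle_ineq4[of "g x - c y (2 * d)" "g y - c y (2 * d)"]
      by simp
    also have "\<dots> = P * d powr \<beta>"
      using d by (simp add: P_def powr_mult algebra_simps)
    finally show ?thesis by (simp add: d_def)
  qed simp
  have [measurable]: "g \<in> borel_measurable lebesgue"
  proof -
    have "continuous_on UNIV g"
      unfolding continuous_on_def
    proof
      fix x :: "real ^ 'n"
      have "((\<lambda>y. norm (y - x)) \<longlongrightarrow> 0) (at x)" by (auto intro!: tendsto_eq_intros)
      then have "((\<lambda>y. P * norm (y - x) powr \<beta>) \<longlongrightarrow> P * 0 powr \<beta>) (at x)"
        using \<beta> by (intro tendsto_mult tendsto_const tendsto_powr2) auto
      then have "((\<lambda>y. P * norm (y - x) powr \<beta>) \<longlongrightarrow> 0) (at x)" by simp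
      then have "((\<lambda>y. g y - g x) \<longlongrightarrow> 0) (at x)"
        by (rule Lim_null_comparison[rotated]) (simp add: lip)
      then show "(g \<longlongrightarrow> g x) (at x)" by (simp add: LIM_zero_cancel)
    qed
    then have "g \<in> borel_measurable borel" by (rule borel_measurable_continuous_onI)
    then show ?thesis by (intro measurable_completion) simp
  qed
  \<comment> \<open>\<open>T\<close> is the oscillation of b about \<open>c x r\<close>;
    \<open>P * n powr \<beta>\<close> bounds the variation of g over a cube of diameter at most n l,
    and \<open>L\<close> the distance from \<open>g x\<close> to \<open>c x r\<close>.\<close>
  define S where "S = T + (P * n powr \<beta> + L)"
  have "AE x in lebesgue. ennreal (norm (b x - g x)) = 0"
  proof (rule AE_zero_of_small_cube_integrals[OF _ \<beta>, of _ S])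
    fix a :: "real ^ 'n" and l :: real assume l: "0 < l"
    define r where "r = l / 2"
    define x where "x = a + vec r"
    have r: "0 < r" "l = 2 * r" using l by (auto simp: r_def)
    have Qx: "cbox a (a + vec l) = Q x r" by (simp add: Q_def x_def r_def)
    have "x \<in> Q x r" using r by (simp add: Q_def centered_cube)
    have [measurable]: "Q x r \<in> sets lebesgue" by (simp add: Q_def)
    have gc: "norm (g y - c x r) \<le> (P * n powr \<beta> + L) * l powr \<beta>" if "y \<in> Q x r" for y
    proof -
      have "norm (y - x) \<le> n * l"
        using norm_diff_cube[of y a l x] that \<open>x \<in> Q x r\<close> unfolding Qx n_def by simp
      then have "norm (y - x) powr \<beta> \<le> (n * l) powr \<beta>"
        using \<beta> by (intro powr_mono2) auto
      then have "P * norm (y - x) powr \<beta> \<le> P * (n powr \<beta> * l powr \<beta>)"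
        using P l by (intro mult_left_mono) (auto simp: powr_mult)
      then have "norm (g y - g x) \<le> P * n powr \<beta> * l powr \<beta>"
        using lip[of y x] by simp
      moreover have "norm (g x - c x r) \<le> L * l powr \<beta>"
      proof -
        have "L * r powr \<beta> \<le> L * l powr \<beta>"
          using L r \<beta> by (intro mult_left_mono powr_mono2) auto
        then show ?thesis using g_c[OF r(1), of x] by simp
      qed
      ultimately show ?thesis
        using norm_triangle_ineq[of "g y - g x" "g x - c x r"] by (simp add: distrib_right)
    qed
    have "(\<integral>\<^sup>+y\<in>Q x r. ennreal (norm (b y - g y)) \<partial>lebesgue) \<le>
        (\<integral>\<^sup>+y. ennreal (norm (b y - c x r)) * indicator (Q x r) y +
          ennreal ((P * n powr \<beta> + L) * l powr \<beta>) * indicator (Q x r) y \<partial>lebesgue)"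
    proof (rule nn_integral_mono)
      fix y
      show "ennreal (norm (b y - g y)) * indicator (Q x r) y \<le> ennreal (norm (b y - c x r)) * indicator (Q x r) y +
          ennreal ((P * n powr \<beta> + L) * l powr \<beta>) * indicator (Q x r) y"
      proof (cases "y \<in> Q x r")
        case True
        have "norm (b y - g y) \<le> norm (b y - c x r) + (P * n powr \<beta> + L) * l powr \<beta>"
          using gc[OF True] norm_triangle_ineq4[of "b y - c x r" "g y - c x r"] by simp
        then show ?thesis using True P L
          by (simp add: ennreal_plus[symmetric] ennreal_leI del: ennreal_plus)
      qed simp
    qed
    also have "\<dots> = (\<integral>\<^sup>+y\<in>Q x r. ennreal (norm (b y - c x r)) \<partial>lebesgue) +
        ennreal ((P * n powr \<beta> + L) * l powr \<beta>) * emeasure lebesgue (Q x r)"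
      by (subst nn_integral_add) (auto simp: nn_integral_cmult_indicator)
    also have "\<dots> \<le> ennreal (T * l powr \<beta> * l ^ n) + ennreal ((P * n powr \<beta> + L) * l powr \<beta>) * ennreal (l ^ n)"
      using c[OF r(1), of x] r
      by (intro add_mono mult_left_mono) (auto simp: Q_def emeasure_cube n_def)
    also have "\<dots> = ennreal (S * l powr \<beta> * l ^ n)"
      using P L T l by (simp add: S_def ennreal_mult[symmetric] ennreal_plus[symmetric] algebra_simps del: ennreal_plus)
    finally show "(\<integral>\<^sup>+y\<in>cbox a (a + vec l). ennreal (norm (b y - g y)) \<partial>lebesgue) \<le>
        ennreal (S * l powr \<beta> * l ^ CARD('n))"
      unfolding Qx n_def .
  qed (use P L T in \<open>auto simp: S_def\<close>)
  then have "AE x in lebesgue. b x = g x" by simp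
  with lip show ?thesis unfolding in_Lipschitz_space_def by blast
qed

subsection \<open>From boundedness to the Lipschitz condition\<close>

text \<open>The restrictions of b to growing balls are measurable and at each point eventually equal
  to b.\<close>

lemma locally_integrable_measurable:
  fixes b :: "real ^ 'n \<Rightarrow> 'a::euclidean_space"
  assumes "locally_integrable b"
  shows "b \<in> borel_measurable lebesgue"
proof (rule borel_measurable_LIMSEQ_metric)
  fix k :: nat
  have "b absolutely_integrable_on cball 0 (real k)"
    using assms by (simp add: locally_integrable_def)
  then show "(\<lambda>x. indicator (cball 0 (real k)) x *\<^sub>R b x) \<in> borel_measurable lebesgue"
    unfolding set_integrable_def by (rule borel_measurable_integrable)
next
  fix x :: "real ^ 'n"
  obtain k0 where k0: "norm x \<le> real k0" using real_arch_simple by blast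
  have "indicator (cball 0 (real k)) x *\<^sub>R b x = b x" if "k0 \<le> k" for k
    using k0 that by simp
  then have "\<forall>\<^sub>F k in sequentially. indicator (cball 0 (real k)) x *\<^sub>R b x = b x"
    by (rule eventually_sequentiallyI)
  then show "(\<lambda>k. indicator (cball 0 (real k)) x *\<^sub>R b x) \<longlonglongrightarrow> b x"
    by (rule tendsto_eventually)
qed

section \<open>Testing on the indicator function of a cube\<close>

definition cube_fun :: "real ^ 'n \<Rightarrow> real \<Rightarrow> real ^ 'n \<Rightarrow> 'a::real_normed_field" where
  "cube_fun a l y = (if y \<in> cbox a (a + vec l) then 1 else 0)"

lemma norm_cube_fun: "norm (cube_fun a l y) = indicator (cbox a (a + vec l)) y"
  by (simp add: cube_fun_def)

lemma measurable_cube_fun: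
  "(cube_fun a l :: real ^ 'n \<Rightarrow> 'a::{real_normed_field, euclidean_space}) \<in> borel_measurable lebesgue"
proof -
  have [measurable]: "cbox a (a + vec l) \<in> sets lebesgue" by simp
  have "(\<lambda>y. if y \<in> cbox a (a + vec l) then 1 else 0 :: 'a) \<in> borel_measurable lebesgue"
    by measurable
  then show ?thesis by (simp add: cube_fun_def[abs_def])
qed

lemma Lp_norm_cube_fun:
  assumes "0 < l" "0 < p"
  shows "Lp_norm p (cube_fun a l :: real ^ 'n \<Rightarrow> 'a::{real_normed_field, euclidean_space}) =
    ennreal (l powr (CARD('n) / p))"
proof -
  have [measurable]: "cbox a (a + vec l) \<in> sets lebesgue" by simp
  have "(\<lambda>x. ennreal (indicator (cbox a (a + vec l)) x)) \<in> borel_measurable lebesgue" by measurable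
  moreover have "(\<integral>\<^sup>+x. ennreal_powr (ennreal (indicator (cbox a (a + vec l)) x)) p \<partial>lebesgue) =
      (\<integral>\<^sup>+x. indicator (cbox a (a + vec l)) x \<partial>lebesgue)"
    by (intro nn_integral_cong) (auto simp: ennreal_powr_ennreal split: split_indicator)
  ultimately show ?thesis
    using assms
    by (simp add: Lp_norm_def ennreal_Lp_norm_def norm_cube_fun emeasure_cube ennreal_powr_ennreal
        powr_realpow[symmetric] powr_powr)
qed

lemma cube_fun_in_Lp:
  assumes "0 < l" "0 < p"
  shows "(cube_fun a l :: real ^ 'n \<Rightarrow> 'a::{real_normed_field, euclidean_space}) \<in> Lp p"
  using Lp_norm_cube_fun[OF assms, of a, where 'a='a] measurable_cube_fun by (simp add: Lp_def)

text \<open>A single point of each cube at which the maximal commutator of the indicator function is under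
  control suffices: its value of \<open>b\<close> serves as the constant in the oscillation estimate.\<close>

lemma in_Lipschitz_space_if_maximal_commutator_point:
  fixes b :: "real ^ 'n \<Rightarrow> 'a::{real_normed_field, euclidean_space}"
    and \<beta> :: real
  assumes "b \<in> borel_measurable lebesgue" "0 < \<beta>" "0 \<le> T"
    and pt: "\<And>a l. 0 < l \<Longrightarrow>
      \<exists>x\<in>cbox a (a + vec l). maximal_commutator b (cube_fun a l) x \<le> ennreal (T * l powr \<beta>)"
  shows "in_Lipschitz_space \<beta> b"
  using assms(1-3)
proof (rule in_Lipschitz_space_if_oscillation)
  fix a :: "real ^ 'n" and l :: real assume l: "0 < l"
  let ?Q = "cbox a (a + vec l)"
  obtain x where x: "x \<in> ?Q" "maximal_commutator b (cube_fun a l) x \<le> ennreal (T * l powr \<beta>)"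
    using pt[OF l] by blast
  have "(\<integral>\<^sup>+y\<in>?Q. ennreal (norm (b y - b x)) \<partial>lebesgue) =
      (\<integral>\<^sup>+y\<in>?Q. ennreal (norm (b x - b y) * norm (cube_fun a l y :: 'a)) \<partial>lebesgue)"
    by (intro nn_integral_cong) (auto simp: norm_cube_fun norm_minus_commute split: split_indicator)
  also have "\<dots> \<le> ennreal (T * l powr \<beta>) * ennreal (l ^ CARD('n))"
    using x l by (auto simp: maximal_commutator_eq_cube_maximal cube_maximal_le_iff)
  also have "\<dots> = ennreal (T * l powr \<beta> * l ^ CARD('n))"
    using l \<open>0 \<le> T\<close> by (simp add: ennreal_mult)
  finally show "\<exists>c. (\<integral>\<^sup>+y\<in>?Q. ennreal (norm (b y - c)) \<partial>lebesgue) \<le> ennreal (T * l powr \<beta> * l ^ CARD('n))"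
    by blast
qed

text \<open>If the commutator of the indicator exceeded \<open>T * l powr \<beta>\<close> on all of
  the cube, the estimate would give T l^(\<beta> + n/q) \<le> C l^(n/p). The two exponents agree, so
  T could not exceed C.\<close>

lemma in_Lipschitz_space_if_strong_type:
  fixes b :: "real ^ 'n \<Rightarrow> 'a::{real_normed_field, euclidean_space}"
    and \<beta> :: real
  assumes "b \<in> borel_measurable lebesgue" "0 < \<beta>" "0 < p" "0 < q" "1 / q = 1 / p - \<beta> / CARD('n)"
    and bd: "bounded_from_Lp (maximal_commutator b) p (ennreal_Lp_norm q)"
  shows "in_Lipschitz_space \<beta> b"
proof -
  let ?n = "real CARD('n)"
  obtain C where C: "\<And>f. f \<in> Lp p \<Longrightarrow>
      ennreal_Lp_norm q (maximal_commutator b f) \<le> ennreal C * Lp_norm p f"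
    using bd unfolding bounded_from_Lp_def by blast
  \<comment> \<open>\<open>C\<close> is an arbitrary real, and \<open>ennreal C\<close> is 0 if it
    is negative; hence \<open>T\<close> must be positive as well as larger than
    \<open>C\<close>.\<close>
  define T where "T = \<bar>C\<bar> + 1"
  have T: "0 < T" "C < T" by (auto simp: T_def)
  show ?thesis
    using assms(1,2)
  proof (rule in_Lipschitz_space_if_maximal_commutator_point)
    show "0 \<le> T" using T by simp
    fix a :: "real ^ 'n" and l :: real assume l: "0 < l"
    let ?Q = "cbox a (a + vec l)" and ?m = "maximal_commutator b (cube_fun a l)"
    show "\<exists>x\<in>?Q. ?m x \<le> ennreal (T * l powr \<beta>)"
    proof (rule ccontr)
      assume "\<not> (\<exists>x\<in>?Q. ?m x \<le> ennreal (T * l powr \<beta>))"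
      then have big: "ennreal (T * l powr \<beta>) \<le> ?m x" if "x \<in> ?Q" for x
        using that by (auto simp: not_le less_imp_le)
      have exps: "\<beta> + ?n / q = ?n / p"
      proof -
        have "?n * (1 / q) = ?n * (1 / p - \<beta> / ?n)" using assms(5) by simp
        then show ?thesis by (simp add: right_diff_distrib)
      qed
      have "ennreal ((T * l powr \<beta>) powr q) * emeasure lebesgue ?Q =
          (\<integral>\<^sup>+x. ennreal ((T * l powr \<beta>) powr q) * indicator ?Q x \<partial>lebesgue)"
        by (rule nn_integral_cmult_indicator[symmetric]) simp
      also have "\<dots> \<le> (\<integral>\<^sup>+x. ennreal_powr (?m x) q \<partial>lebesgue)"
      proof (rule nn_integral_mono)
        fix x
        show "ennreal ((T * l powr \<beta>) powr q) * indicator ?Q x \<le> ennreal_powr (?m x) q"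
          using ennreal_powr_mono[OF big, of x q] T assms(4)
          by (auto simp: ennreal_powr_ennreal split: split_indicator)
      qed
      finally have "ennreal ((T * l powr \<beta>) powr q * l powr ?n) \<le> (\<integral>\<^sup>+x. ennreal_powr (?m x) q \<partial>lebesgue)"
        using l by (simp add: emeasure_cube ennreal_mult powr_realpow)
      then have "ennreal_powr (ennreal ((T * l powr \<beta>) powr q * l powr ?n)) (1 / q) \<le>
          ennreal_powr (\<integral>\<^sup>+x. ennreal_powr (?m x) q \<partial>lebesgue) (1 / q)"
        using assms(4) by (intro ennreal_powr_mono) auto
      \<comment> \<open>For a non-measurable function the right-hand side is \<infinity> by
        definition, so the inequality holds in either case.\<close>
      also have "\<dots> \<le> ennreal_Lp_norm q ?m" by (simp add: ennreal_Lp_norm_def)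
      also have "\<dots> \<le> ennreal C * Lp_norm p (cube_fun a l :: real ^ 'n \<Rightarrow> 'a)"
        using l assms(3) by (intro C cube_fun_in_Lp)
      also have "\<dots> = ennreal (C * l powr (?n / p))"
        using l assms(3) by (simp add: Lp_norm_cube_fun ennreal_mult'')
      also have "ennreal_powr (ennreal ((T * l powr \<beta>) powr q * l powr ?n)) (1 / q) =
          ennreal (T * l powr \<beta> * l powr (?n / q))"
        using T l assms(4) by (simp add: ennreal_powr_ennreal powr_mult powr_powr)
      also have "T * l powr \<beta> * l powr (?n / q) = T * l powr (?n / p)"
        by (simp add: exps[symmetric] powr_add)
      finally have "ennreal (T * l powr (?n / p)) \<le> ennreal (C * l powr (?n / p))" .
      moreover have "C * l powr (?n / p) < T * l powr (?n / p)" "0 < T * l powr (?n / p)"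
        using T l by simp_all
      ultimately show False by (simp add: ennreal_le_iff2)
    qed
  qed
qed

text \<open>At height \<open>T * l powr \<beta>\<close> a superlevel set containing the cube forces
  l^n \<le> C (l^(n - \<beta>) / T)^r, and (n - \<beta>) r = n reduces this to T^r \<le> C.\<close>

lemma in_Lipschitz_space_if_weak_type:
  fixes b :: "real ^ 'n \<Rightarrow> 'a::{real_normed_field, euclidean_space}"
    and \<beta> :: real
  assumes b: "b \<in> borel_measurable lebesgue" "0 < \<beta>" "\<beta> < CARD('n)" and "0 < C"
    and bd: "\<And>f t. f \<in> Lp 1 \<Longrightarrow> 0 < t \<Longrightarrow> emeasure lebesgue {x. maximal_commutator b f x > ennreal t}
      \<le> ennreal C * ennreal_powr (Lp_norm 1 f / ennreal t) (CARD('n) / (CARD('n) - \<beta>))"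
  shows "in_Lipschitz_space \<beta> b"
proof -
  let ?n = "real CARD('n)"
  define r where "r = ?n / (?n - \<beta>)"
  have r: "0 < r" "(?n - \<beta>) * r = ?n" using assms(3) by (auto simp: r_def)
  \<comment> \<open>Chosen so that T^r = C + 1 exceeds C.\<close>
  define T where "T = (C + 1) powr (1 / r)"
  have T: "0 < T" "T powr r = C + 1" using \<open>0 < C\<close> r by (auto simp: T_def powr_powr)
  show ?thesis
    using assms(1,2)
  proof (rule in_Lipschitz_space_if_maximal_commutator_point)
    show "0 \<le> T" using T by simp
    fix a :: "real ^ 'n" and l :: real assume l: "0 < l"
    let ?Q = "cbox a (a + vec l)" and ?m = "maximal_commutator b (cube_fun a l)"
    let ?t = "T * l powr \<beta>"
    have t: "0 < ?t" using T l by simp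
    show "\<exists>x\<in>?Q. ?m x \<le> ennreal ?t"
    proof (rule ccontr)
      assume "\<not> (\<exists>x\<in>?Q. ?m x \<le> ennreal ?t)"
      then have sub: "?Q \<subseteq> {x. ?m x > ennreal ?t}" by (auto simp: not_le)
      \<comment> \<open>A non-measurable set has \<open>emeasure\<close> 0 by convention, so
        monotonicity depends on this.\<close>
      have "{x. ?m x > ennreal ?t} \<in> sets lebesgue"
        by (intro sets_superlevel measurable_maximal_commutator b measurable_cube_fun)
      with sub have "emeasure lebesgue ?Q \<le> emeasure lebesgue {x. ?m x > ennreal ?t}"
        by (rule emeasure_mono)
      also have "\<dots> \<le> ennreal C * ennreal_powr (Lp_norm 1 (cube_fun a l :: real ^ 'n \<Rightarrow> 'a) / ennreal ?t) r"
        unfolding r_def by (rule bd[OF cube_fun_in_Lp[OF l zero_less_one] t])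
      also have "Lp_norm 1 (cube_fun a l :: real ^ 'n \<Rightarrow> 'a) / ennreal ?t = ennreal (l powr (?n - \<beta>) / T)"
      proof -
        have "l powr ?n / ?t = l powr (?n - \<beta>) / T"
          using l by (simp add: powr_diff)
        then show ?thesis
          using Lp_norm_cube_fun[OF l zero_less_one, of a, where 'a = 'a] t by (simp add: divide_ennreal)
      qed
      also have "ennreal C * ennreal_powr (ennreal (l powr (?n - \<beta>) / T)) r = ennreal (C * (l powr ?n / (C + 1)))"
        using T l r \<open>0 < C\<close>
        by (simp add: ennreal_powr_ennreal powr_divide powr_powr ennreal_mult[symmetric])
      finally have "ennreal (l powr ?n) \<le> ennreal (C * (l powr ?n / (C + 1)))"
        using l by (simp add: emeasure_cube powr_realpow)
      then have "l powr ?n \<le> C * (l powr ?n / (C + 1))"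
        using \<open>0 < C\<close> by (subst (asm) ennreal_le_iff) auto
      moreover have "0 < l powr ?n" using l by simp
      ultimately show False using \<open>0 < C\<close> by (simp add: field_simps)
    qed
  qed
qed

text \<open>For the exponent n / \<beta> the indicator has norm \<open>l powr \<beta>\<close>. A
  bound almost everywhere must hold at some point of the cube, whose measure is positive.\<close>

lemma in_Lipschitz_space_if_Linf_bound:
  fixes b :: "real ^ 'n \<Rightarrow> 'a::{real_normed_field, euclidean_space}"
    and \<beta> :: real
  assumes b: "b \<in> borel_measurable lebesgue" "0 < \<beta>"
    and bd: "bounded_from_Lp (maximal_commutator b) (CARD('n) / \<beta>) ennreal_Linf_norm"
  shows "in_Lipschitz_space \<beta> b"
proof -
  let ?n = "real CARD('n)"
  obtain C where C: "\<And>f. f \<in> Lp (?n / \<beta>) \<Longrightarrow>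
      ennreal_Linf_norm (maximal_commutator b f) \<le> ennreal C * Lp_norm (?n / \<beta>) f"
    using bd unfolding bounded_from_Lp_def by blast
  have p: "0 < ?n / \<beta>" using assms(2) by simp
  show ?thesis
    using assms(1,2)
  proof (rule in_Lipschitz_space_if_maximal_commutator_point)
    show "0 \<le> \<bar>C\<bar>" by simp
    fix a :: "real ^ 'n" and l :: real assume l: "0 < l"
    let ?Q = "cbox a (a + vec l)" and ?m = "maximal_commutator b (cube_fun a l)"
    have "esssup lebesgue ?m \<le> ennreal C * Lp_norm (?n / \<beta>) (cube_fun a l :: real ^ 'n \<Rightarrow> 'a)"
      using C[OF cube_fun_in_Lp[OF l p]] by (simp add: ennreal_Linf_norm_def)
    also have "\<dots> = ennreal (C * l powr \<beta>)"
      using Lp_norm_cube_fun[OF l p, of a, where 'a = 'a] assms(2) by (simp add: ennreal_mult'')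
    also have "\<dots> \<le> ennreal (\<bar>C\<bar> * l powr \<beta>)"
      by (intro ennreal_leI mult_right_mono) auto
    finally have ess: "esssup lebesgue ?m \<le> ennreal (\<bar>C\<bar> * l powr \<beta>)" .
    have AE_le: "AE x in lebesgue. ?m x \<le> ennreal (\<bar>C\<bar> * l powr \<beta>)"
      by (rule AE_mp[OF esssup_AE], rule AE_I2) (use ess in \<open>auto intro: order_trans\<close>)
    show "\<exists>x\<in>?Q. ?m x \<le> ennreal (\<bar>C\<bar> * l powr \<beta>)"
    proof (rule ccontr)
      assume none: "\<not> ?thesis"
      have "AE x in lebesgue. x \<notin> ?Q"
        by (rule AE_mp[OF AE_le], rule AE_I2) (use none in auto)
      then have "emeasure lebesgue ?Q = 0" by (subst (asm) AE_iff_measurable[OF _ refl]) auto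
      then show False using l by (simp add: emeasure_cube)
    qed
  qed
qed

subsection \<open>From the Lipschitz condition to boundedness\<close>

text \<open>Replaces the norm by a real number \<open>N\<close>, so that the later computations with
  exponents take place in the reals.\<close>

lemma LpE:
  fixes f :: "real ^ 'n \<Rightarrow> 'a::euclidean_space"
  assumes "f \<in> Lp p" "0 < p"
  obtains N where "f \<in> borel_measurable lebesgue" "0 \<le> N" "Lp_norm p f = ennreal N"
    "(\<integral>\<^sup>+x. ennreal (norm (f x) powr p) \<partial>lebesgue) = ennreal (N powr p)"
proof -
  have [measurable]: "f \<in> borel_measurable lebesgue" and fin: "Lp_norm p f < \<infinity>"
    using assms by (auto simp: Lp_def)
  have "(\<lambda>x. ennreal (norm (f x))) \<in> borel_measurable lebesgue" by measurable
  then have *: "Lp_norm p f = ennreal_powr (\<integral>\<^sup>+x. ennreal (norm (f x) powr p) \<partial>lebesgue) (1 / p)"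
    by (simp add: Lp_norm_def ennreal_Lp_norm_def ennreal_powr_ennreal)
  then have "(\<integral>\<^sup>+x. ennreal (norm (f x) powr p) \<partial>lebesgue) < top"
    using fin by simp
  then obtain J where J: "0 \<le> J" "(\<integral>\<^sup>+x. ennreal (norm (f x) powr p) \<partial>lebesgue) = ennreal J"
    by (cases "\<integral>\<^sup>+x. ennreal (norm (f x) powr p) \<partial>lebesgue") auto
  show thesis
  proof (rule that[of "J powr (1 / p)"])
    show "(\<integral>\<^sup>+x. ennreal (norm (f x) powr p) \<partial>lebesgue) = ennreal ((J powr (1 / p)) powr p)"
      using J assms(2) by (simp add: powr_powr)
    show "Lp_norm p f = ennreal (J powr (1 / p))"
      using J by (simp add: * ennreal_powr_ennreal)
  qed auto
qed

text \<open>Disposes of functions of norm 0; the estimates below use negative powers of the norm and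
  assume it positive.\<close>

lemma maximal_commutator_eq_0:
  fixes f :: "real ^ 'n \<Rightarrow> 'a::{real_normed_field, euclidean_space}"
  assumes [measurable]: "f \<in> borel_measurable lebesgue"
    and "(\<integral>\<^sup>+x. ennreal (norm (f x) powr p) \<partial>lebesgue) = 0"
  shows "maximal_commutator b f = (\<lambda>_. 0)"
proof
  fix x
  have AE0: "AE y in lebesgue. f y = 0"
    using assms(2) by (subst (asm) nn_integral_0_iff_AE) auto
  have "(\<integral>\<^sup>+y\<in>Q. ennreal (norm (b x - b y) * norm (f y)) \<partial>lebesgue) = (\<integral>\<^sup>+(y :: real ^ 'n). 0 \<partial>lebesgue)" for Q
    by (rule nn_integral_cong_AE, rule AE_mp[OF AE0]) auto
  then have "maximal_commutator b f x \<le> 0"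
    by (simp add: maximal_commutator_eq_cube_maximal cube_maximal_le_iff del: le_zero_eq)
  then show "maximal_commutator b f x = 0" by simp
qed

text \<open>Hoelder's inequality up to the factor 2, from the pointwise bound u \<le> t + t^(1 - p)
  u^p: where u exceeds t, the power u^(1 - p) is at most t^(1 - p).\<close>

lemma nn_integral_cube_le_Lp:
  fixes u :: "real ^ 'n \<Rightarrow> real"
  assumes [measurable]: "u \<in> borel_measurable lebesgue" and u: "\<And>y. 0 \<le> u y"
    and p: "1 \<le> p" and N: "0 < N" "(\<integral>\<^sup>+y. ennreal (u y powr p) \<partial>lebesgue) \<le> ennreal (N powr p)" and l: "0 < l"
  shows "(\<integral>\<^sup>+y\<in>cbox a (a + vec l). ennreal (u y) \<partial>lebesgue) \<le>
    ennreal (2 * N * l powr (- (CARD('n) / p)) * l ^ CARD('n))"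
proof -
  let ?Q = "cbox a (a + vec l)"
  let ?n = "real CARD('n)"
  have [measurable]: "?Q \<in> sets lebesgue" by simp
  \<comment> \<open>This threshold makes both terms contribute t l^n, which is where the factor 2
    comes from.\<close>
  define t where "t = N * l powr (- (?n / p))"
  have t: "0 < t" using N l by (simp add: t_def)
  have "(\<integral>\<^sup>+y\<in>?Q. ennreal (u y) \<partial>lebesgue) \<le>
      (\<integral>\<^sup>+y. ennreal t * indicator ?Q y + ennreal (t powr (1 - p)) * ennreal (u y powr p) \<partial>lebesgue)"
  proof (rule nn_integral_mono)
    fix y
    have "u y \<le> t + t powr (1 - p) * u y powr p"
    proof (cases "u y \<le> t")
      case False
      then have pos: "0 < u y" using t by simp
      have "u y powr 1 = u y powr (1 - p) * u y powr p" by (simp add: powr_add[symmetric])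
      also have "\<dots> \<le> t powr (1 - p) * u y powr p"
        using False t p by (intro mult_right_mono powr_mono2') auto
      finally show ?thesis using pos t by simp
    qed (use t in \<open>auto intro: add_increasing2\<close>)
    then have "ennreal (u y) \<le> ennreal t + ennreal (t powr (1 - p)) * ennreal (u y powr p)"
      using t by (simp add: ennreal_mult[symmetric] ennreal_plus[symmetric] ennreal_leI del: ennreal_plus)
    then show "ennreal (u y) * indicator ?Q y \<le> ennreal t * indicator ?Q y + ennreal (t powr (1 - p)) * ennreal (u y powr p)"
      by (auto split: split_indicator)
  qed
  also have "\<dots> = ennreal t * ennreal (l ^ CARD('n)) + ennreal (t powr (1 - p)) * (\<integral>\<^sup>+y. ennreal (u y powr p) \<partial>lebesgue)"
    using l by (subst nn_integral_add) (auto simp: nn_integral_cmult_indicator nn_integral_cmult emeasure_cube)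
  also have "\<dots> \<le> ennreal t * ennreal (l ^ CARD('n)) + ennreal (t powr (1 - p)) * ennreal (N powr p)"
    using N by (intro add_left_mono mult_left_mono) auto
  also have "\<dots> = ennreal (t * l ^ CARD('n) + t powr (1 - p) * N powr p)"
    using t l by (simp add: ennreal_mult[symmetric] ennreal_plus[symmetric] del: ennreal_plus)
  also have "t powr (1 - p) * N powr p = t * l ^ CARD('n)"
  proof -
    have "N powr p = t powr p * l powr ?n"
      using N l p by (simp add: t_def powr_mult powr_powr mult.assoc powr_add[symmetric])
    then have "t powr (1 - p) * N powr p = (t powr (1 - p) * t powr p) * l powr ?n" by simp
    also have "t powr (1 - p) * t powr p = t" using t by (simp add: powr_add[symmetric])
    finally show ?thesis using l by (simp add: powr_realpow)
  qed
  finally show ?thesis by (simp add: t_def algebra_simps)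
qed

lemma nn_integral_commutator_cube_le:
  fixes b f :: "real ^ 'n \<Rightarrow> 'a::{real_normed_field, euclidean_space}"
    and \<beta> :: real
  assumes [measurable]: "f \<in> borel_measurable lebesgue" and C: "0 \<le> C" "0 < \<beta>"
    and lip: "AE y in lebesgue. norm (b x - b y) \<le> C * norm (x - y) powr \<beta>"
    and l: "0 < l" "x \<in> cbox a (a + vec l)"
  shows "(\<integral>\<^sup>+y\<in>cbox a (a + vec l). ennreal (norm (b x - b y) * norm (f y)) \<partial>lebesgue) \<le>
    ennreal (C * CARD('n) powr \<beta> * l powr \<beta>) * (\<integral>\<^sup>+y\<in>cbox a (a + vec l). ennreal (norm (f y)) \<partial>lebesgue)"
proof -
  let ?Q = "cbox a (a + vec l)"
  let ?n = "real CARD('n)"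
  have [measurable]: "?Q \<in> sets lebesgue" by simp
  have "AE y in lebesgue. ennreal (norm (b x - b y) * norm (f y)) * indicator ?Q y \<le>
      ennreal (C * ?n powr \<beta> * l powr \<beta>) * (ennreal (norm (f y)) * indicator ?Q y)"
    using lip
  proof (rule AE_mp, intro AE_I2 impI)
    fix y assume y: "norm (b x - b y) \<le> C * norm (x - y) powr \<beta>"
    show "ennreal (norm (b x - b y) * norm (f y)) * indicator ?Q y \<le>
      ennreal (C * ?n powr \<beta> * l powr \<beta>) * (ennreal (norm (f y)) * indicator ?Q y)"
    proof (cases "y \<in> ?Q")
      case True
      note y
      also have "C * norm (x - y) powr \<beta> \<le> C * (?n * l) powr \<beta>"
        using norm_diff_cube[OF l(2) True] C by (intro mult_left_mono powr_mono2) auto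
      also have "\<dots> = C * ?n powr \<beta> * l powr \<beta>" using l by (simp add: powr_mult)
      finally have "norm (b x - b y) * norm (f y) \<le> C * ?n powr \<beta> * l powr \<beta> * norm (f y)"
        by (rule mult_right_mono) simp
      then show ?thesis using True C by (simp add: ennreal_mult[symmetric] ennreal_leI)
    qed simp
  qed
  then have "(\<integral>\<^sup>+y\<in>?Q. ennreal (norm (b x - b y) * norm (f y)) \<partial>lebesgue) \<le>
      (\<integral>\<^sup>+y. ennreal (C * ?n powr \<beta> * l powr \<beta>) * (ennreal (norm (f y)) * indicator ?Q y) \<partial>lebesgue)"
    by (rule nn_integral_mono_AE)
  also have "\<dots> = ennreal (C * ?n powr \<beta> * l powr \<beta>) * (\<integral>\<^sup>+y\<in>?Q. ennreal (norm (f y)) \<partial>lebesgue)"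
    by (rule nn_integral_cmult) measurable
  finally show ?thesis .
qed

text \<open>Hedberg's argument: an average \<open>v\<close> of \<open>f\<close> is split as \<open>v powr s * v powr (1 - s)\<close>; the first
  factor is estimated by the \<open>L\<^sup>p\<close> norm, which absorbs the side length, and the second by the maximal
  function.\<close>

lemma maximal_commutator_le_cube_maximal:
  fixes b f :: "real ^ 'n \<Rightarrow> 'a::{real_normed_field, euclidean_space}"
    and \<beta> :: real
  assumes [measurable]: "f \<in> borel_measurable lebesgue" and C: "0 < C" "0 < \<beta>"
    and lip: "AE y in lebesgue. norm (b x - b y) \<le> C * norm (x - y) powr \<beta>"
    and p: "1 \<le> p" and N: "0 < N" "(\<integral>\<^sup>+y. ennreal (norm (f y) powr p) \<partial>lebesgue) \<le> ennreal (N powr p)"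
    and s: "s = p * \<beta> / CARD('n)" "s < 1"
  shows "maximal_commutator b f x \<le>
    ennreal (C * CARD('n) powr \<beta> * (2 * N) powr s) *
    ennreal_powr (cube_maximal (\<lambda>y. ennreal (norm (f y))) x) (1 - s)"
  unfolding maximal_commutator_eq_cube_maximal cube_maximal_le_iff[of _ x "_ * _"]
proof (intro allI impI)
  fix a :: "real ^ 'n" and l :: real assume l: "0 < l" and x: "x \<in> cbox a (a + vec l)"
  let ?Q = "cbox a (a + vec l)"
  let ?n = "real CARD('n)"
  let ?D = "C * ?n powr \<beta>"
  let ?M = "cube_maximal (\<lambda>y. ennreal (norm (f y))) x"
  have s0: "0 \<le> s" using s C p by simp
  have hoelder: "(\<integral>\<^sup>+y\<in>?Q. ennreal (norm (f y)) \<partial>lebesgue) \<le> ennreal (2 * N * l powr (- (?n / p)) * l ^ CARD('n))"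
    using p N l by (intro nn_integral_cube_le_Lp) auto
  then have "(\<integral>\<^sup>+y\<in>?Q. ennreal (norm (f y)) \<partial>lebesgue) < top"
    using ennreal_less_top le_less_trans by blast
  then obtain w where w: "0 \<le> w" "(\<integral>\<^sup>+y\<in>?Q. ennreal (norm (f y)) \<partial>lebesgue) = ennreal w"
    by (cases "\<integral>\<^sup>+y\<in>?Q. ennreal (norm (f y)) \<partial>lebesgue") auto
  define v where "v = w / l ^ CARD('n)"
  have v: "0 \<le> v" "(\<integral>\<^sup>+y\<in>?Q. ennreal (norm (f y)) \<partial>lebesgue) = ennreal (v * l ^ CARD('n))"
    using w l by (auto simp: v_def)
  have "v * l ^ CARD('n) \<le> 2 * N * l powr (- (?n / p)) * l ^ CARD('n)"
    using hoelder N l unfolding v(2) by (subst (asm) ennreal_le_iff) auto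
  then have v_le: "v \<le> 2 * N * l powr (- (?n / p))" using l by simp
  have "ennreal (v * l ^ CARD('n)) \<le> ?M * ennreal (l ^ CARD('n))"
    using nn_integral_cube_le_cube_maximal[OF l x, of "\<lambda>y. ennreal (norm (f y))"] v(2) by simp
  then have v_M: "ennreal v \<le> ?M"
  proof (cases ?M)
    case (real m)
    then have "ennreal (v * l ^ CARD('n)) \<le> ennreal (m * l ^ CARD('n))"
      using \<open>ennreal (v * l ^ CARD('n)) \<le> _\<close> l by (simp add: ennreal_mult)
    then have "v * l ^ CARD('n) \<le> m * l ^ CARD('n)"
      using real l by (subst (asm) ennreal_le_iff) auto
    then show ?thesis using real l by (simp add: ennreal_leI)
  qed simp
  \<comment> \<open>Since (n / p) s = \<beta>, the factor \<open>v powr s\<close> is at most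
    \<open>(2 * N) powr s * l powr (- \<beta>)\<close>, which consumes the whole factor
    \<open>l powr \<beta>\<close>.\<close>
  have key: "l powr \<beta> * v \<le> (2 * N) powr s * v powr (1 - s)"
  proof -
    have "v powr s \<le> (2 * N * l powr (- (?n / p))) powr s"
      using v v_le s0 by (intro powr_mono2) auto
    also have "\<dots> = (2 * N) powr s * l powr (- \<beta>)"
    proof -
      have "?n / p * s = \<beta>" using s p by simp
      then show ?thesis using N l by (simp add: powr_mult powr_powr)
    qed
    finally have *: "l powr \<beta> * v powr s \<le> (2 * N) powr s"
      using l by (simp add: powr_minus field_simps)
    have "v = v powr s * v powr (1 - s)"
      using v by (cases "v = 0") (auto simp: powr_add[symmetric])
    then have "l powr \<beta> * v = (l powr \<beta> * v powr s) * v powr (1 - s)" by (simp add: mult.assoc)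
    also have "\<dots> \<le> (2 * N) powr s * v powr (1 - s)" using * by (rule mult_right_mono) simp
    finally show ?thesis .
  qed
  have "(\<integral>\<^sup>+y\<in>?Q. ennreal (norm (b x - b y) * norm (f y)) \<partial>lebesgue) \<le>
      ennreal (?D * l powr \<beta>) * (\<integral>\<^sup>+y\<in>?Q. ennreal (norm (f y)) \<partial>lebesgue)"
    using C lip l x by (intro nn_integral_commutator_cube_le) auto
  also have "\<dots> = ennreal (?D * (l powr \<beta> * v) * l ^ CARD('n))"
    using C l v(1) unfolding v(2) by (simp add: ennreal_mult[symmetric] mult_ac)
  also have "\<dots> \<le> ennreal (?D * ((2 * N) powr s * v powr (1 - s)) * l ^ CARD('n))"
    using key C l by (intro ennreal_leI mult_right_mono mult_left_mono) auto
  also have "\<dots> = ennreal (?D * (2 * N) powr s) * ennreal_powr (ennreal v) (1 - s) * ennreal (l ^ CARD('n))"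
    using C N l v by (simp add: ennreal_powr_ennreal ennreal_mult[symmetric] mult_ac)
  also have "\<dots> \<le> ennreal (?D * (2 * N) powr s) * ennreal_powr ?M (1 - s) * ennreal (l ^ CARD('n))"
    using v_M s(2) by (intro mult_right_mono mult_left_mono ennreal_powr_mono) auto
  finally show "(\<integral>\<^sup>+y\<in>?Q. ennreal (norm (b x - b y) * norm (f y)) \<partial>lebesgue) \<le>
      ennreal (?D * (2 * N) powr s) * ennreal_powr ?M (1 - s) * ennreal (l ^ CARD('n))" .
qed

text \<open>The case s = 1 of Hedberg's splitting: the bound on the average decays like
  \<open>l powr (- \<beta>)\<close>, which alone cancels \<open>l powr \<beta>\<close>.\<close>

lemma maximal_commutator_le_endpoint:
  fixes b f :: "real ^ 'n \<Rightarrow> 'a::{real_normed_field, euclidean_space}"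
    and \<beta> :: real
  assumes [measurable]: "f \<in> borel_measurable lebesgue" and C: "0 \<le> C" "0 < \<beta>" "\<beta> \<le> CARD('n)"
    and lip: "AE y in lebesgue. norm (b x - b y) \<le> C * norm (x - y) powr \<beta>"
    and N: "0 < N" "(\<integral>\<^sup>+y. ennreal (norm (f y) powr (CARD('n) / \<beta>)) \<partial>lebesgue) \<le> ennreal (N powr (CARD('n) / \<beta>))"
  shows "maximal_commutator b f x \<le> ennreal (C * CARD('n) powr \<beta> * 2 * N)"
  unfolding maximal_commutator_eq_cube_maximal cube_maximal_le_iff
proof (intro allI impI)
  fix a :: "real ^ 'n" and l :: real assume l: "0 < l" and x: "x \<in> cbox a (a + vec l)"
  let ?Q = "cbox a (a + vec l)"
  let ?n = "real CARD('n)"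
  have "(\<integral>\<^sup>+y\<in>?Q. ennreal (norm (b x - b y) * norm (f y)) \<partial>lebesgue) \<le>
      ennreal (C * ?n powr \<beta> * l powr \<beta>) * (\<integral>\<^sup>+y\<in>?Q. ennreal (norm (f y)) \<partial>lebesgue)"
    using C lip l x by (intro nn_integral_commutator_cube_le) auto
  also have "\<dots> \<le> ennreal (C * ?n powr \<beta> * l powr \<beta>) * ennreal (2 * N * l powr (- (?n / (?n / \<beta>))) * l ^ CARD('n))"
    using C N l by (intro mult_left_mono nn_integral_cube_le_Lp) auto
  also have "\<dots> = ennreal (C * ?n powr \<beta> * 2 * N * l ^ CARD('n) * (l powr \<beta> * l powr (- \<beta>)))"
    using C N l by (simp add: ennreal_mult[symmetric] mult_ac)
  also have "\<dots> = ennreal (C * ?n powr \<beta> * 2 * N) * ennreal (l ^ CARD('n))"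
    using C N l by (simp add: ennreal_mult powr_minus)
  finally show "(\<integral>\<^sup>+y\<in>?Q. ennreal (norm (b x - b y) * norm (f y)) \<partial>lebesgue) \<le>
      ennreal (C * ?n powr \<beta> * 2 * N) * ennreal (l ^ CARD('n))" .
qed

text \<open>Both x and y have to avoid the null set where b differs from its Lipschitz
  representative. The iterated form fits the commutator: x is fixed first, then y is integrated
  out.\<close>

lemma in_Lipschitz_spaceE:
  fixes b :: "real ^ 'n \<Rightarrow> 'a::euclidean_space"
    and \<beta> :: real
  assumes "in_Lipschitz_space \<beta> b"
  obtains C where "0 < C" "AE x in lebesgue. AE y in lebesgue. norm (b x - b y) \<le> C * norm (x - y) powr \<beta>"
proof -
  obtain g C where gC: "\<And>x y. norm (g x - g y) \<le> C * norm (x - y) powr \<beta>" and bg: "AE x in lebesgue. b x = g x"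
    using assms unfolding in_Lipschitz_space_def by blast
  have le: "norm (g x - g y) \<le> (\<bar>C\<bar> + 1) * norm (x - y) powr \<beta>" for x y
  proof -
    have "C \<le> \<bar>C\<bar> + 1" by linarith
    then have "C * norm (x - y) powr \<beta> \<le> (\<bar>C\<bar> + 1) * norm (x - y) powr \<beta>"
      by (rule mult_right_mono) simp
    with gC[of x y] show ?thesis by linarith
  qed
  have "AE x in lebesgue. AE y in lebesgue. norm (b x - b y) \<le> (\<bar>C\<bar> + 1) * norm (x - y) powr \<beta>"
  proof (rule AE_mp[OF bg], rule AE_I2, rule impI)
    fix x assume x: "b x = g x"
    show "AE y in lebesgue. norm (b x - b y) \<le> (\<bar>C\<bar> + 1) * norm (x - y) powr \<beta>"
      using bg by (rule AE_mp) (auto simp: x le)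
  qed
  then show thesis by (intro that[of "\<bar>C\<bar> + 1"]) auto
qed

text \<open>Raising Hedberg's bound to the power q produces the p-th power of the maximal function,
  as (1 - s) q = p. The norm enters as N^s from the splitting and as N^(1 - s) from the maximal
  theorem, hence linearly in all.\<close>

lemma strong_type_if_in_Lipschitz_space:
  fixes b :: "real ^ 'n \<Rightarrow> 'a::{real_normed_field, euclidean_space}"
    and \<beta> :: real
  assumes b: "b \<in> borel_measurable lebesgue" "0 < \<beta>" "in_Lipschitz_space \<beta> b"
    and p: "1 < p" "p < CARD('n) / \<beta>" "1 / q = 1 / p - \<beta> / CARD('n)"
  shows "bounded_from_Lp (maximal_commutator b) p (ennreal_Lp_norm q)"
proof -
  let ?n = "real CARD('n)"
  obtain C where C: "0 < C" "AE x in lebesgue. AE y in lebesgue. norm (b x - b y) \<le> C * norm (x - y) powr \<beta>"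
    using in_Lipschitz_spaceE[OF b(3)] .
  obtain B where B: "0 < B" "\<forall>u\<in>borel_measurable lebesgue. (\<forall>x :: real ^ 'n. 0 \<le> u x) \<longrightarrow>
       (\<integral>\<^sup>+x. ennreal_powr (cube_maximal (\<lambda>y. ennreal (u y)) x) p \<partial>lebesgue) \<le>
       ennreal B * (\<integral>\<^sup>+x. ennreal (u x powr p) \<partial>lebesgue)"
    using cube_maximal_strong_type[OF p(1)] by blast
  define s where "s = p * \<beta> / ?n"
  have s: "s < 1" using p b(2) by (simp add: s_def field_simps)
  have pq: "p / q = 1 - s"
  proof -
    have "p / q = p * (1 / q)" by simp
    also have "\<dots> = 1 - s" unfolding p(3) using p(1) by (simp add: s_def right_diff_distrib)
    finally show ?thesis .
  qed
  have q: "0 < q" using pq s p(1) by (smt (verit) divide_nonneg_nonpos)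
  have qs: "(1 - s) * q = p" using pq[symmetric] q by simp
  define A where "A = C * ?n powr \<beta> * 2 powr s"
  have A: "0 < A" using C by (simp add: A_def)
  have "ennreal_Lp_norm q (maximal_commutator b f) \<le> ennreal (A * B powr (1 / q)) * Lp_norm p f" if f: "f \<in> Lp p" for f
  proof -
    obtain N where N: "f \<in> borel_measurable lebesgue" "0 \<le> N" "Lp_norm p f = ennreal N"
        "(\<integral>\<^sup>+x. ennreal (norm (f x) powr p) \<partial>lebesgue) = ennreal (N powr p)"
      using LpE[OF f] p by auto
    note [measurable] = N(1) b(1)
    have [measurable]: "maximal_commutator b f \<in> borel_measurable lebesgue"
      by (intro measurable_maximal_commutator b N)
    have norm_eq: "ennreal_Lp_norm q (maximal_commutator b f) =
        ennreal_powr (\<integral>\<^sup>+x. ennreal_powr (maximal_commutator b f x) q \<partial>lebesgue) (1 / q)"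
      by (simp add: ennreal_Lp_norm_def)
    show ?thesis
    proof (cases "N = 0")
      case True
      then have "maximal_commutator b f = (\<lambda>_. 0)" using N by (intro maximal_commutator_eq_0) auto
      then show ?thesis by (simp add: ennreal_Lp_norm_def)
    next
      case False
      then have N0: "0 < N" using N by simp
      let ?M = "cube_maximal (\<lambda>y. ennreal (norm (f y)))"
      have [measurable]: "?M \<in> borel_measurable lebesgue"
        by (rule measurable_cube_maximal_const) measurable
      define D where "D = C * ?n powr \<beta> * (2 * N) powr s"
      have D: "D = A * N powr s" "0 < D" using C N0 by (auto simp: D_def A_def powr_mult)
      have "AE x in lebesgue. ennreal_powr (maximal_commutator b f x) q \<le>
          ennreal (D powr q) * ennreal_powr (?M x) p"
        using C(2)
      proof (rule AE_mp, intro AE_I2 impI)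
        fix x assume "AE y in lebesgue. norm (b x - b y) \<le> C * norm (x - y) powr \<beta>"
        then have "maximal_commutator b f x \<le> ennreal D * ennreal_powr (?M x) (1 - s)"
          unfolding D_def using N N0 C(1) b(2) p s
          by (intro maximal_commutator_le_cube_maximal[where p = p]) (auto simp: s_def)
        then have "ennreal_powr (maximal_commutator b f x) q \<le> ennreal_powr (ennreal D * ennreal_powr (?M x) (1 - s)) q"
          using q by (intro ennreal_powr_mono) auto
        also have "\<dots> = ennreal (D powr q) * ennreal_powr (?M x) p"
          using D(2) by (simp add: ennreal_powr_mult ennreal_powr_powr qs)
        finally show "ennreal_powr (maximal_commutator b f x) q \<le> ennreal (D powr q) * ennreal_powr (?M x) p" .
      qed
      then have "(\<integral>\<^sup>+x. ennreal_powr (maximal_commutator b f x) q \<partial>lebesgue) \<le>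
          (\<integral>\<^sup>+x. ennreal (D powr q) * ennreal_powr (?M x) p \<partial>lebesgue)"
        by (rule nn_integral_mono_AE)
      also have "\<dots> = ennreal (D powr q) * (\<integral>\<^sup>+x. ennreal_powr (?M x) p \<partial>lebesgue)"
        by (rule nn_integral_cmult) measurable
      also have "\<dots> \<le> ennreal (D powr q) * (ennreal B * ennreal (N powr p))"
        using B(2)[THEN bspec, of "\<lambda>x. norm (f x)"] N(4) by (intro mult_left_mono) auto
      also have "\<dots> = ennreal (D powr q * (B * N powr p))"
        using B by (simp add: ennreal_mult)
      finally have "ennreal_Lp_norm q (maximal_commutator b f) \<le> ennreal_powr (ennreal (D powr q * (B * N powr p))) (1 / q)"
        unfolding norm_eq using q by (intro ennreal_powr_mono) auto
      also have "\<dots> = ennreal (D * (B powr (1 / q) * N powr (p / q)))"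
        using D(2) B(1) N0 q by (simp add: ennreal_powr_ennreal powr_mult powr_powr)
      also have "D * (B powr (1 / q) * N powr (p / q)) = A * B powr (1 / q) * (N powr s * N powr (1 - s))"
        by (simp add: D(1) pq)
      also have "N powr s * N powr (1 - s) = N" using N0 by (simp add: powr_add[symmetric])
      finally show ?thesis using A N by (simp add: ennreal_mult)
    qed
  qed
  then show ?thesis unfolding bounded_from_Lp_def by blast
qed

lemma weak_type_if_in_Lipschitz_space:
  fixes b :: "real ^ 'n \<Rightarrow> 'a::{real_normed_field, euclidean_space}"
    and \<beta> :: real
  assumes b: "b \<in> borel_measurable lebesgue" "0 < \<beta>" "\<beta> < CARD('n)" "in_Lipschitz_space \<beta> b"
  obtains C where "0 < C" "\<And>f t. f \<in> Lp 1 \<Longrightarrow> 0 < t \<Longrightarrow>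
    emeasure lebesgue {x. maximal_commutator b f x > ennreal t}
      \<le> ennreal C * ennreal_powr (Lp_norm 1 f / ennreal t) (CARD('n) / (CARD('n) - \<beta>))"
proof -
  let ?n = "real CARD('n)"
  obtain C where C: "0 < C" "AE x in lebesgue. AE y in lebesgue. norm (b x - b y) \<le> C * norm (x - y) powr \<beta>"
    using in_Lipschitz_spaceE[OF b(4)] .
  define s where "s = \<beta> / ?n"
  have s: "s < 1" using b by (simp add: s_def)
  define r where "r = ?n / (?n - \<beta>)"
  have r: "(1 - s) * r = 1" "1 + s * r = r" using b by (auto simp: r_def s_def field_simps)
  define W where "W = weak_const TYPE('n)"
  have W: "0 < W" by (simp add: W_def weak_const_pos)
  define A where "A = C * ?n powr \<beta> * 2 powr s"
  have A: "0 < A" using C by (simp add: A_def)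
  show thesis
  proof (rule that)
    \<comment> \<open>With D = A N^s, the weak estimate at height (t / D)^r gives W N (D / t)^r, and
      N^(1 + s r) = N^r leaves W A^r (N / t)^r.\<close>
    show "0 < W * A powr r" using W A by simp
    fix f :: "real ^ 'n \<Rightarrow> 'a" and t :: real assume f: "f \<in> Lp 1" and t: "0 < t"
    obtain N where N: "f \<in> borel_measurable lebesgue" "0 \<le> N" "Lp_norm 1 f = ennreal N"
        "(\<integral>\<^sup>+x. ennreal (norm (f x) powr 1) \<partial>lebesgue) = ennreal (N powr 1)"
      using LpE[OF f] by auto
    note [measurable] = N(1) b(1)
    have "emeasure lebesgue {x. maximal_commutator b f x > ennreal t} \<le>
        ennreal (W * A powr r) * ennreal_powr (Lp_norm 1 f / ennreal t) r"
    proof (cases "N = 0")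
      case True
      then have "maximal_commutator b f = (\<lambda>_. 0)" using N by (intro maximal_commutator_eq_0[where p = 1]) auto
      then show ?thesis by simp
    next
      case False
      then have N0: "0 < N" using N by simp
      let ?M = "cube_maximal (\<lambda>y. ennreal (norm (f y)))"
      have [measurable]: "?M \<in> borel_measurable lebesgue"
        by (rule measurable_cube_maximal_const) measurable
      define D where "D = C * ?n powr \<beta> * (2 * N) powr s"
      have D: "D = A * N powr s" "0 < D" using C N0 by (auto simp: D_def A_def powr_mult)
      \<comment> \<open>The height at which Hedberg's bound \<open>D * \<tau> powr (1 - s)\<close>
        equals t. Thus a commutator above t forces the maximal function above \<open>\<tau>\<close>,
        at almost every point.\<close>
      define \<tau> where "\<tau> = (t / D) powr r"
      have \<tau>: "0 < \<tau>" "D * \<tau> powr (1 - s) = t"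
        using t D r(1) by (auto simp: \<tau>_def powr_powr mult.commute)
      have "AE x in lebesgue. maximal_commutator b f x > ennreal t \<longrightarrow> ?M x > ennreal \<tau>"
        using C(2)
      proof (rule AE_mp, intro AE_I2 impI)
        fix x assume x: "AE y in lebesgue. norm (b x - b y) \<le> C * norm (x - y) powr \<beta>"
          and big: "maximal_commutator b f x > ennreal t"
        show "?M x > ennreal \<tau>"
        proof (rule ccontr)
          assume "\<not> ?M x > ennreal \<tau>"
          then have "?M x \<le> ennreal \<tau>" by simp
          have "maximal_commutator b f x \<le> ennreal D * ennreal_powr (?M x) (1 - s)"
            unfolding D_def using N N0 C(1) b(2) x s
            by (intro maximal_commutator_le_cube_maximal[where p = 1]) (auto simp: s_def)
          also have "\<dots> \<le> ennreal D * ennreal_powr (ennreal \<tau>) (1 - s)"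
            using \<open>?M x \<le> ennreal \<tau>\<close> s by (intro mult_left_mono ennreal_powr_mono) auto
          also have "\<dots> = ennreal t"
            using \<tau> D(2) by (simp add: ennreal_powr_ennreal ennreal_mult[symmetric])
          finally show False using big by simp
        qed
      qed
      moreover have "{x. ?M x > ennreal \<tau>} \<in> sets lebesgue" by (rule sets_superlevel) measurable
      ultimately have "emeasure lebesgue {x. maximal_commutator b f x > ennreal t} \<le> emeasure lebesgue {x. ?M x > ennreal \<tau>}"
        by (intro emeasure_mono_AE) auto
      also have "\<dots> \<le> ennreal (W / \<tau>) * (\<integral>\<^sup>+x. ennreal (norm (f x)) \<partial>lebesgue)"
        unfolding W_def using \<tau> by (intro cube_maximal_weak_type) auto
      also have "\<dots> = ennreal (W / \<tau> * N)"
        using N N0 W \<tau> by (simp add: ennreal_mult[symmetric])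
      also have "W / \<tau> * N = W * A powr r * (N / t) powr r"
      proof -
        have "1 / \<tau> = (D / t) powr r" using t D by (simp add: \<tau>_def powr_divide)
        also have "\<dots> = A powr r * N powr (s * r) / t powr r"
          using A N0 t by (simp add: D(1) powr_mult powr_divide powr_powr)
        finally have *: "1 / \<tau> = A powr r * N powr (s * r) / t powr r" .
        have Nr: "N * N powr (s * r) = N powr r"
          using N0 powr_add[of N 1 "s * r"] r(2) by simp
        have "W / \<tau> * N = W * N * (1 / \<tau>)" by simp
        also have "\<dots> = W * (A powr r * (N * N powr (s * r)) / t powr r)"
          unfolding * by simp
        finally show ?thesis
          unfolding Nr using N0 t by (simp add: powr_divide)
      qed
      finally show ?thesis
        using N0 t W by (simp add: N(3) divide_ennreal ennreal_powr_ennreal ennreal_mult)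
    qed
    then show "emeasure lebesgue {x. maximal_commutator b f x > ennreal t} \<le>
        ennreal (W * A powr r) * ennreal_powr (Lp_norm 1 f / ennreal t) (?n / (?n - \<beta>))"
      by (simp add: r_def)
  qed
qed

lemma Linf_bound_if_in_Lipschitz_space:
  fixes b :: "real ^ 'n \<Rightarrow> 'a::{real_normed_field, euclidean_space}"
    and \<beta> :: real
  assumes b: "b \<in> borel_measurable lebesgue" "0 < \<beta>" "\<beta> \<le> CARD('n)" "in_Lipschitz_space \<beta> b"
  shows "bounded_from_Lp (maximal_commutator b) (CARD('n) / \<beta>) ennreal_Linf_norm"
proof -
  let ?n = "real CARD('n)"
  obtain C where C: "0 < C" "AE x in lebesgue. AE y in lebesgue. norm (b x - b y) \<le> C * norm (x - y) powr \<beta>"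
    using in_Lipschitz_spaceE[OF b(4)] .
  have "ennreal_Linf_norm (maximal_commutator b f) \<le> ennreal (C * ?n powr \<beta> * 2) * Lp_norm (?n / \<beta>) f"
    if f: "f \<in> Lp (?n / \<beta>)" for f
  proof -
    obtain N where N: "f \<in> borel_measurable lebesgue" "0 \<le> N" "Lp_norm (?n / \<beta>) f = ennreal N"
        "(\<integral>\<^sup>+x. ennreal (norm (f x) powr (?n / \<beta>)) \<partial>lebesgue) = ennreal (N powr (?n / \<beta>))"
      using LpE[OF f] b(2) by auto
    have "AE x in lebesgue. maximal_commutator b f x \<le> ennreal (C * ?n powr \<beta> * 2 * N)"
    proof (cases "N = 0")
      case True
      then have "maximal_commutator b f = (\<lambda>_. 0)" using N by (intro maximal_commutator_eq_0) auto
      then show ?thesis by simp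
    next
      case False
      show ?thesis
        using C(2) by (rule AE_mp) (use False N C(1) b in \<open>auto intro!: AE_I2 maximal_commutator_le_endpoint\<close>)
    qed
    then have "esssup lebesgue (maximal_commutator b f) \<le> ennreal (C * ?n powr \<beta> * 2 * N)"
      by (intro esssup_I measurable_maximal_commutator b N)
    then show ?thesis
      using C N by (simp add: ennreal_Linf_norm_def ennreal_mult)
  qed
  then show ?thesis unfolding bounded_from_Lp_def by blast
qed

theorem theorem1p1:
  fixes b :: "real ^ 'n \<Rightarrow> 'a::{real_normed_field, euclidean_space}"
    and \<beta> :: real
  assumes "locally_integrable b" and "0 < \<beta>" and "\<beta> < 1"
  shows
    "let n = real CARD('n) in
     (in_Lipschitz_space \<beta> b \<longleftrightarrow>
        (\<forall>p q :: real. 1 < p \<and> p < n / \<beta> \<and> 1 / q = 1 / p - \<beta> / n \<longrightarrow>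
           bounded_from_Lp (maximal_commutator b) p (ennreal_Lp_norm q))) \<and>
     (in_Lipschitz_space \<beta> b \<longleftrightarrow>
        (\<exists>p q :: real. 1 < p \<and> p < n / \<beta> \<and> 1 / q = 1 / p - \<beta> / n \<and>
           bounded_from_Lp (maximal_commutator b) p (ennreal_Lp_norm q))) \<and>
     (in_Lipschitz_space \<beta> b \<longleftrightarrow>
        (\<exists>C::real. C > 0 \<and> (\<forall>f\<in>Lp 1. \<forall>t::real. t > 0 \<longrightarrow>
           emeasure lebesgue {x. maximal_commutator b f x > ennreal t}
             \<le> ennreal C * ennreal_powr (Lp_norm 1 f / ennreal t) (n / (n - \<beta>))))) \<and>
     (in_Lipschitz_space \<beta> b \<longleftrightarrow>
        bounded_from_Lp (maximal_commutator b) (n / \<beta>) ennreal_Linf_norm)"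
proof -
  define n where "n = real CARD('n)"
  have n: "1 \<le> n" by (simp add: n_def Suc_le_eq)
  have \<beta>n: "\<beta> < n" using n assms by simp
  have b: "b \<in> borel_measurable lebesgue" by (rule locally_integrable_measurable) fact
  let ?adm = "\<lambda>p q. 1 < p \<and> p < n / \<beta> \<and> 1 / q = 1 / p - \<beta> / n"
  let ?bd = "\<lambda>p q. bounded_from_Lp (maximal_commutator b) p (ennreal_Lp_norm q)"
  have strong: "?bd p q" if "in_Lipschitz_space \<beta> b" "?adm p q" for p q
    using strong_type_if_in_Lipschitz_space[OF b assms(2) that(1)] that(2) by (simp add: n_def)
  have lip: "in_Lipschitz_space \<beta> b" if "?adm p q" "?bd p q" for p q
  proof (rule in_Lipschitz_space_if_strong_type[OF b assms(2) _ _ _ that(2)])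
    \<comment> \<open>The sign of q is prescribed only through its reciprocal, so it has to be
      recovered from p < n / \<beta>.\<close>
    have "\<beta> / n < 1 / p" using that(1) assms(2) n by (simp add: field_simps)
    then have "0 < 1 / q" using that(1) by simp
    then show "0 < q" by simp
  qed (use that in \<open>auto simp: n_def\<close>)
  \<comment> \<open>An admissible pair exists because \<beta> < n. It rules out that statement (2)
    holds vacuously and supplies the witness for statement (3).\<close>
  obtain p q where pq: "?adm p q"
  proof -
    have "1 < n / \<beta>" using \<beta>n assms by simp
    then obtain p where p: "1 < p" "p < n / \<beta>" using dense by blast
    then show thesis by (intro that[of p "1 / (1 / p - \<beta> / n)"]) simp
  qed
  have 2: "in_Lipschitz_space \<beta> b \<longleftrightarrow> (\<forall>p q. ?adm p q \<longrightarrow> ?bd p q)"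
    using strong lip pq by blast
  have 3: "in_Lipschitz_space \<beta> b \<longleftrightarrow> (\<exists>p q. 1 < p \<and> p < n / \<beta> \<and> 1 / q = 1 / p - \<beta> / n \<and> ?bd p q)"
    using strong lip pq by blast
  have 4: "in_Lipschitz_space \<beta> b \<longleftrightarrow> (\<exists>C::real. C > 0 \<and> (\<forall>f\<in>Lp 1. \<forall>t::real. t > 0 \<longrightarrow>
           emeasure lebesgue {x. maximal_commutator b f x > ennreal t}
             \<le> ennreal C * ennreal_powr (Lp_norm 1 f / ennreal t) (n / (n - \<beta>))))" (is "_ \<longleftrightarrow> ?weak")
  proof
    assume "in_Lipschitz_space \<beta> b"
    with \<beta>n show ?weak
      unfolding n_def by (rule weak_type_if_in_Lipschitz_space[OF b assms(2)]) blast
  next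
    assume ?weak
    then show "in_Lipschitz_space \<beta> b"
      using in_Lipschitz_space_if_weak_type[OF b assms(2) \<beta>n[unfolded n_def]] unfolding n_def by blast
  qed
  have 5: "in_Lipschitz_space \<beta> b \<longleftrightarrow> bounded_from_Lp (maximal_commutator b) (n / \<beta>) ennreal_Linf_norm"
    using in_Lipschitz_space_if_Linf_bound[OF b assms(2)]
      Linf_bound_if_in_Lipschitz_space[OF b assms(2)] \<beta>n unfolding n_def by auto
  show ?thesis
    unfolding Let_def n_def[symmetric] using 2 3 4 5 by blast
qed

end
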